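(* Let $M=(E,\mathcal{L})$ be a uniform oriented matroid of rank $d+1$ in covector representation, with $\mathcal{L}\subseteq\{-,0,+\}^E$. Assume that $E$ is partitioned into $d$ classes (colors) $E=E_1\sqcup\dots\sqcup E_d$ and that $M$ is well-separated with respect to this partition. Then for every $\alpha\in[|E_1|]\times\dots\times[|E_d|]$ there is a covector $v^\alpha\in\mathcal{L}$ with exactly one zero and exactly $\alpha_i-1$ minuses on the subset $E_i$, for all $i\in[d]$.
   Context: $[n]=\{1,\dots,n\}$. $E$ is the (finite) ground set and $\mathcal{L}$ is the set of covectors of the oriented matroid. For $e\in E$, let $c(e)\in[d]$ denote the color of $e$, i.e. the index with $e\in E_{c(e)}$. $M$ (with the partition $E=E_1\sqcup\dots\sqcup E_d$) is well-separated if for all $s\in\{-,+\}^d$ there exists a covector $v\in\mathcal{L}$ with $v_e=s_{c(e)}$ for all $e\in E$. *)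

theory Defs
  imports Main "HOL-Library.FuncSet" "HOL-Library.Disjoint_Sets"
begin

datatype sign = Minus | Zero | Plus

fun neg_sign :: "sign \<Rightarrow> sign" where
  "neg_sign Minus = Plus"
| "neg_sign Zero = Zero"
| "neg_sign Plus = Minus"

(* A sign vector over E is a total function that is Zero off E; this gives each element of
   {-,0,+}^E exactly one representative. Zeros and minuses must thus be counted inside E. *)
definition sign_vectors :: "'a set \<Rightarrow> ('a \<Rightarrow> sign) set" where
  "sign_vectors E = {v. \<forall>e. e \<notin> E \<longrightarrow> v e = Zero}"

definition compose_sv :: "('a \<Rightarrow> sign) \<Rightarrow> ('a \<Rightarrow> sign) \<Rightarrow> 'a \<Rightarrow> sign" where
  "compose_sv X Y = (\<lambda>e. if X e \<noteq> Zero then X e else Y e)"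

definition separation_set :: "('a \<Rightarrow> sign) \<Rightarrow> ('a \<Rightarrow> sign) \<Rightarrow> 'a set" where
  "separation_set X Y = {e. X e \<noteq> Zero \<and> Y e = neg_sign (X e)}"

locale oriented_matroid =
  fixes E :: "'a set" and L :: "('a \<Rightarrow> sign) set"
  assumes finite_ground: "finite E"
    and covectors_subset: "L \<subseteq> sign_vectors E"
    and zero_covector: "(\<lambda>e. Zero) \<in> L"
    and neg_covector: "X \<in> L \<Longrightarrow> (\<lambda>e. neg_sign (X e)) \<in> L"
    and compose_covector: "X \<in> L \<Longrightarrow> Y \<in> L \<Longrightarrow> compose_sv X Y \<in> L"
    and covector_elimination:
      "X \<in> L \<Longrightarrow> Y \<in> L \<Longrightarrow> e \<in> separation_set X Y \<Longrightarrow>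
        \<exists>Z\<in>L. Z e = Zero \<and> (\<forall>f\<in>E - separation_set X Y. Z f = compose_sv X Y f)"

(* The underlying matroid is the one whose flats are the zero sets of the covectors;
   the closure of A is the intersection of all flats containing A. *)
definition zero_set :: "'a set \<Rightarrow> ('a \<Rightarrow> sign) \<Rightarrow> 'a set" where
  "zero_set E v = {e \<in> E. v e = Zero}"

definition om_closure :: "'a set \<Rightarrow> ('a \<Rightarrow> sign) set \<Rightarrow> 'a set \<Rightarrow> 'a set" where
  "om_closure E L A = \<Inter> {F \<in> zero_set E ` L. A \<subseteq> F}"

definition om_indep :: "'a set \<Rightarrow> ('a \<Rightarrow> sign) set \<Rightarrow> 'a set \<Rightarrow> bool" where
  "om_indep E L A \<longleftrightarrow> A \<subseteq> E \<and> (\<forall>e\<in>A. e \<notin> om_closure E L (A - {e}))"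

definition om_basis :: "'a set \<Rightarrow> ('a \<Rightarrow> sign) set \<Rightarrow> 'a set \<Rightarrow> bool" where
  "om_basis E L B \<longleftrightarrow> om_indep E L B \<and> (\<forall>A. om_indep E L A \<and> B \<subseteq> A \<longrightarrow> A = B)"

definition om_rank :: "'a set \<Rightarrow> ('a \<Rightarrow> sign) set \<Rightarrow> nat" where
  "om_rank E L = Max (card ` {A. om_indep E L A})"

definition om_uniform :: "'a set \<Rightarrow> ('a \<Rightarrow> sign) set \<Rightarrow> bool" where
  "om_uniform E L \<longleftrightarrow> (\<forall>B. B \<subseteq> E \<and> card B = om_rank E L \<longrightarrow> om_basis E L B)"

definition color_partition :: "'a set \<Rightarrow> nat \<Rightarrow> (nat \<Rightarrow> 'a set) \<Rightarrow> bool" where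
  "color_partition E d P \<longleftrightarrow> disjoint_family_on P {1..d} \<and> (\<Union>i\<in>{1..d}. P i) = E"

definition color :: "nat \<Rightarrow> (nat \<Rightarrow> 'a set) \<Rightarrow> 'a \<Rightarrow> nat" where
  "color d P e = (THE i. i \<in> {1..d} \<and> e \<in> P i)"

definition well_separated ::
    "'a set \<Rightarrow> ('a \<Rightarrow> sign) set \<Rightarrow> nat \<Rightarrow> (nat \<Rightarrow> 'a set) \<Rightarrow> bool" where
  "well_separated E L d P \<longleftrightarrow>
    (\<forall>s \<in> {1..d} \<rightarrow> {Minus, Plus}. \<exists>v\<in>L. \<forall>e\<in>E. v e = s (color d P e))"

end

theory Submission
  imports Defs
begin

text \<open>Think of a covector as a hyperplane with a positive side, meeting the elements where it vanishes.
Call it mixed if it is nonzero and neither constantly \<open>Plus\<close> nor constantly \<open>Minus\<close> on any color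
class; geometrically, the hyperplane meets the convex hull of every class. For well-separated
point sets in general position the space of these hyperplanes has two components, and reversing
sides exchanges them. The proof transfers this fact to oriented matroids, as the existence of a set
that contains exactly one of each mixed covector and its negative and does not separate comparable
mixed covectors (\<open>orientation_exists\<close>). Such a set is called an orientation below.

An orientation \<open>A\<close> gives the theorem by counting. Each choice of one element from every class is the
zero set of a covector in \<open>A\<close>. Suppose that \<open>v\<close> and \<open>w\<close> are distinct covectors of this kind with the
same number of minuses on every class. On a class where they differ, \<open>v\<close> exceeds \<open>w\<close> at some element
and falls below it at another one. Hence every covector obtained by eliminating between \<open>v\<close> and
\<open>opp w\<close> is mixed, these covectors form a path from \<open>v\<close> to \<open>opp w\<close>, and \<open>opp w\<close> lies in \<open>A\<close> together
with \<open>w\<close>, which is impossible (\<open>colorful_determined_by_counts\<close>). So choices of elements map injectively to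
vectors of counts. There are as many of the former as of the latter, namely the product of the
class sizes, and therefore every vector of counts occurs.

The orientation is built by induction on the number of colors. Contracting an element \<open>x\<close> of color
\<open>i\<close> lowers the rank by one and leaves the other colors well-separated; the rest of class \<open>i\<close> stays in
the ground set without a color. The contraction has an orientation by induction, and this
orientation is unique up to sign because any two mixed covectors are connected up to sign
(\<open>mixed_connected\<close>). The signs can be chosen so that the orientations for two elements agree on
the mixed covectors vanishing at both: for elements of different colors this reduces to
triangles and to quadrilaterals, the latter being the sign relation \<open>square_signs\<close>, and for elements of
the same color it follows by moving to a further zero, or from well-separation if there are
only two colors (\<open>agree_same_color\<close>). A mixed covector with no zero on a colored element inherits its
side from its proper faces, which are connected to each other in rank at least three
(\<open>faces_connected\<close>).\<close>

section \<open>Signs and uniform oriented matroids\<close>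

abbreviation null :: "'a \<Rightarrow> sign" where
  "null \<equiv> (\<lambda>e. Zero)"

abbreviation opp :: "('a \<Rightarrow> sign) \<Rightarrow> 'a \<Rightarrow> sign" where
  "opp v \<equiv> (\<lambda>e. neg_sign (v e))"

definition conformal_on :: "'a set \<Rightarrow> ('a \<Rightarrow> sign) \<Rightarrow> ('a \<Rightarrow> sign) \<Rightarrow> bool" where
  "conformal_on F u w \<longleftrightarrow> (\<forall>e\<in>F. u e = Zero \<or> u e = w e)"

lemma neg_neg_sign [simp]: "neg_sign (neg_sign s) = s"
  by (cases s) auto

lemma neg_sign_eq_iff [simp]:
  "neg_sign s = Zero \<longleftrightarrow> s = Zero" "neg_sign s = Plus \<longleftrightarrow> s = Minus"
  "neg_sign s = Minus \<longleftrightarrow> s = Plus" "neg_sign s = neg_sign t \<longleftrightarrow> s = t"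
  "Zero = neg_sign s \<longleftrightarrow> s = Zero"   "neg_sign s = s \<longleftrightarrow> s = Zero" "s = neg_sign s \<longleftrightarrow> s = Zero"
  by (cases s; cases t; auto)+

lemma nonzero_sign_cases: "s \<noteq> Zero \<Longrightarrow> t \<noteq> Zero \<Longrightarrow> t = s \<or> t = neg_sign s"
  by (cases s; cases t) auto

lemma opp_null_iff [simp]: "opp v = null \<longleftrightarrow> v = null"
  by (auto simp: fun_eq_iff)

context oriented_matroid
begin

lemma zero_off_ground: "v \<in> L \<Longrightarrow> e \<notin> E \<Longrightarrow> v e = Zero"
  using covectors_subset by (auto simp: sign_vectors_def)

lemma eliminate:
  assumes "X \<in> L" "Y \<in> L" "X e \<noteq> Zero" "Y e = neg_sign (X e)"
  obtains Z where "Z \<in> L" "Z e = Zero"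
    "\<And>f. f \<notin> separation_set X Y \<Longrightarrow> Z f = compose_sv X Y f"
proof -
  have "e \<in> separation_set X Y" using assms by (simp add: separation_set_def)
  from covector_elimination[OF assms(1,2) this] obtain Z where
    Z: "Z \<in> L" "Z e = Zero" "\<forall>f\<in>E - separation_set X Y. Z f = compose_sv X Y f" by blast
  have "Z f = compose_sv X Y f" if "f \<notin> separation_set X Y" for f
    using Z that zero_off_ground[OF Z(1)] zero_off_ground[OF assms(1)] zero_off_ground[OF assms(2)]
    by (cases "f \<in> E") (auto simp: compose_sv_def)
  with Z that show ?thesis by blast
qed

end

text \<open>The proper flats are the zero sets of nonzero covectors. The underlying matroid is uniform of rank
\<open>r\<close> because they have fewer than \<open>r\<close> elements and any \<open>r - 1\<close> elements lie in one of them. In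
this form uniformity passes to contractions by counting zeros.\<close>
locale uniform_om = oriented_matroid E L for E :: "'a set" and L +
  fixes r :: nat
  assumes rank_le_card: "r \<le> card E"
    and few_zeros: "v \<in> L \<Longrightarrow> v \<noteq> null \<Longrightarrow> card (zero_set E v) < r"
    and vanishing_covector: "Z \<subseteq> E \<Longrightarrow> card Z + 1 = r \<Longrightarrow>
      \<exists>v\<in>L. v \<noteq> null \<and> (\<forall>e\<in>Z. v e = Zero)"
begin

lemma null_if_many_zeros:
  assumes "v \<in> L" "Z \<subseteq> E" "r \<le> card Z" "\<And>e. e \<in> Z \<Longrightarrow> v e = Zero"
  shows "v = null"
proof (rule ccontr)
  assume "v \<noteq> null"
  then have "card (zero_set E v) < r" using few_zeros[OF assms(1)] by simp
  moreover have "card Z \<le> card (zero_set E v)"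
    by (rule card_mono) (use finite_ground assms in \<open>auto simp: zero_set_def\<close>)
  ultimately show False using assms by simp
qed

lemma nonzero_off_zeros:
  assumes "v \<in> L" "v \<noteq> null" "Z \<subseteq> E" "card Z + 1 = r" "\<And>e. e \<in> Z \<Longrightarrow> v e = Zero"
    "f \<in> E" "f \<notin> Z"
  shows "v f \<noteq> Zero"
proof
  assume "v f = Zero"
  have "finite Z" using finite_ground assms(3) finite_subset by blast
  then have "v = null"
    by (intro null_if_many_zeros[of v "insert f Z"]) (use assms \<open>v f = Zero\<close> in auto)
  with assms show False by simp
qed

lemma cocircuit_with_sign:
  assumes "Z \<subseteq> E" "card Z + 1 = r" "f \<in> E" "f \<notin> Z" "s \<noteq> Zero"
  obtains v where "v \<in> L" "\<And>e. e \<in> Z \<Longrightarrow> v e = Zero" "v f = s"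
proof -
  obtain v where v: "v \<in> L" "v \<noteq> null" "\<forall>e\<in>Z. v e = Zero"
    using vanishing_covector[OF assms(1,2)] by blast
  then have "v f \<noteq> Zero" using nonzero_off_zeros[OF v(1,2) assms(1,2) _ assms(3,4)] by simp
  then have "v f = s \<or> opp v f = s" using nonzero_sign_cases[of s "v f"] assms by auto
  then show ?thesis
    using v neg_covector[of v] that[of v] that[of "opp v"] by auto
qed

text \<open>Two covectors with the same \<open>r - 1\<close> zeros that agree at \<open>p\<close> and differ at \<open>q\<close> have opposite signs at \<open>q\<close>.
Eliminating \<open>p\<close> from the first and the negative of the second keeps the sign at \<open>q\<close> and produces an
\<open>r\<close>-th zero, too many for a nonzero covector.\<close>
lemma cocircuit_unique:
  assumes "v \<in> L" "w \<in> L" "Z \<subseteq> E" "card Z + 1 = r"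
    and "\<And>e. e \<in> Z \<Longrightarrow> v e = Zero" "\<And>e. e \<in> Z \<Longrightarrow> w e = Zero"
    and "v p = w p" "v p \<noteq> Zero"
  shows "v = w"
proof (rule ccontr)
  assume "v \<noteq> w"
  then obtain q where q: "v q \<noteq> w q" by auto
  have "q \<in> E" using q zero_off_ground[OF assms(1), of q] zero_off_ground[OF assms(2), of q] by metis
  have "q \<notin> Z" using q assms(5,6) by auto
  have nn: "v \<noteq> null" "w \<noteq> null" using assms by auto
  have "v q \<noteq> Zero"
    using nonzero_off_zeros[OF assms(1) nn(1) assms(3,4,5)] \<open>q \<in> E\<close> \<open>q \<notin> Z\<close> by simp
  have "w q \<noteq> Zero"
    using nonzero_off_zeros[OF assms(2) nn(2) assms(3,4,6)] \<open>q \<in> E\<close> \<open>q \<notin> Z\<close> by simp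
  with \<open>v q \<noteq> Zero\<close> have wq: "opp w q = v q" using nonzero_sign_cases[of "v q" "w q"] q by auto
  obtain z where z: "z \<in> L" "z p = Zero"
    "\<And>f. f \<notin> separation_set v (opp w) \<Longrightarrow> z f = compose_sv v (opp w) f"
    by (rule eliminate[of v "opp w" p]) (use assms neg_covector in auto)
  have "z q = v q" using z(3)[of q] wq q \<open>v q \<noteq> Zero\<close>
    by (auto simp: separation_set_def compose_sv_def)
  moreover have "z e = Zero" if "e \<in> Z" for e
    using z(3)[of e] assms(5,6)[OF that] by (auto simp: separation_set_def compose_sv_def)
  moreover have "p \<in> E" "p \<notin> Z" using assms(5,8) zero_off_ground[OF assms(1), of p] by auto
  moreover have "z \<noteq> null" using \<open>z q = v q\<close> \<open>v q \<noteq> Zero\<close> by auto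
  ultimately have "z p \<noteq> Zero"
    using nonzero_off_zeros[OF z(1) _ assms(3,4)] by simp
  with z(2) show False by simp
qed

lemma cocircuit_unique_opp:
  assumes "v \<in> L" "w \<in> L" "Z \<subseteq> E" "card Z + 1 = r"
    and "\<And>e. e \<in> Z \<Longrightarrow> v e = Zero" "\<And>e. e \<in> Z \<Longrightarrow> w e = Zero"
    and "v \<noteq> null" "w \<noteq> null"
  shows "w = v \<or> w = opp v"
proof -
  obtain p where p: "v p \<noteq> Zero" using assms(7) by auto
  then have "p \<in> E" "p \<notin> Z" using assms(5) zero_off_ground[OF assms(1), of p] by auto
  then have "w p \<noteq> Zero" using nonzero_off_zeros[OF assms(2,8,3,4,6)] by simp
  then have "w p = v p \<or> w p = opp v p" using nonzero_sign_cases p by auto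
  then show ?thesis
  proof
    assume "w p = v p"
    then show ?thesis
      using cocircuit_unique[OF assms(2,1,3,4,6,5)] \<open>w p \<noteq> Zero\<close> by blast
  next
    assume "w p = opp v p"
    then show ?thesis
      using cocircuit_unique[OF assms(2) neg_covector[OF assms(1)] assms(3,4,6)] assms(5)
        \<open>w p \<noteq> Zero\<close> by simp
  qed
qed

text \<open>A set of at most \<open>r\<close> elements is independent. So each of its elements has a covector that vanishes
on all others, and compositions of these covectors and their negatives realize every sign pattern.\<close>
lemma any_signs_on_small_set:
  assumes "Z \<subseteq> E" "card Z \<le> r"
  obtains v where "v \<in> L" "\<And>e. e \<in> Z \<Longrightarrow> v e = p e"
proof -
  have finZ: "finite Z" using finite_ground assms(1) finite_subset by blast
  have "\<exists>v\<in>L. (\<forall>e\<in>W. v e = p e) \<and> (\<forall>e\<in>Z-W. v e = Zero)" if "W \<subseteq> Z" for W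
    using finite_subset[OF that finZ] that
  proof (induction W rule: finite_induct)
    case empty
    then show ?case using zero_covector by (intro bexI[of _ null]) auto
  next
    case (insert z W)
    then obtain v where v: "v \<in> L" "\<forall>e\<in>W. v e = p e" "\<forall>e\<in>Z-W. v e = Zero" by auto
    have vz: "v z = Zero" using v insert by auto
    show ?case
    proof (cases "p z = Zero")
      case True
      then show ?thesis using v vz by (intro bexI[of _ v]) auto
    next
      case False
      have "card (Z - {z}) < card Z" using finZ insert.prems by (intro card_Diff1_less) auto
      then have "card (Z - {z}) < r" using assms(2) by simp
      moreover have "card (E - {z}) \<ge> r - 1"
        using rank_le_card by (auto simp: card_Diff_singleton_if)
      moreover have "card (Z - {z}) \<le> r - 1" "Z - {z} \<subseteq> E - {z}"
        using \<open>card (Z - {z}) < r\<close> assms by auto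
      ultimately obtain Z0 where Z0: "Z - {z} \<subseteq> Z0" "Z0 \<subseteq> E - {z}" "card Z0 = r - 1"
        using exists_subset_between[of "Z - {z}" "r - 1" "E - {z}"] finite_ground by blast
      obtain y where y: "y \<in> L" "\<And>e. e \<in> Z0 \<Longrightarrow> y e = Zero" "y z = p z"
        by (rule cocircuit_with_sign[of Z0 z "p z"])
          (use Z0 assms insert.prems False \<open>card (Z - {z}) < r\<close> in auto)
      have "compose_sv v y \<in> L" using compose_covector v y by blast
      moreover have "compose_sv v y e = p e" if "e \<in> insert z W" for e
        using that v vz y insert Z0 by (cases "e = z") (auto simp: compose_sv_def)
      moreover have "compose_sv v y e = Zero" if "e \<in> Z - insert z W" for e
        using that v y Z0 by (auto simp: compose_sv_def)
      ultimately show ?thesis by blast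
    qed
  qed
  from this[of Z] that show ?thesis by auto
qed

text \<open>A covector that vanishes at \<open>x\<close> is literally a sign vector over \<open>E - {x}\<close>, because sign vectors are
extended by \<open>Zero\<close> off the ground set. So contraction is mere selection of covectors.\<close>
lemma contraction:
  assumes "x \<in> E" "0 < r"
  shows "uniform_om (E - {x}) {v \<in> L. v x = Zero} (r - 1)"
proof
  show "finite (E - {x})" using finite_ground by simp
  show "{v \<in> L. v x = Zero} \<subseteq> sign_vectors (E - {x})"
    using zero_off_ground by (auto simp: sign_vectors_def)
  show "null \<in> {v \<in> L. v x = Zero}" using zero_covector by simp
  show "opp X \<in> {v \<in> L. v x = Zero}" if "X \<in> {v \<in> L. v x = Zero}" for X
    using that neg_covector by simp
  show "compose_sv X Y \<in> {v \<in> L. v x = Zero}"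
    if "X \<in> {v \<in> L. v x = Zero}" "Y \<in> {v \<in> L. v x = Zero}" for X Y
    using that compose_covector by (auto simp: compose_sv_def)
  show "\<exists>Z\<in>{v \<in> L. v x = Zero}. Z e = Zero \<and>
      (\<forall>f\<in>E - {x} - separation_set X Y. Z f = compose_sv X Y f)"
    if X: "X \<in> {v \<in> L. v x = Zero}" and Y: "Y \<in> {v \<in> L. v x = Zero}"
      and e: "e \<in> separation_set X Y" for X Y e
  proof -
    obtain Z where Z: "Z \<in> L" "Z e = Zero" "\<forall>f\<in>E - separation_set X Y. Z f = compose_sv X Y f"
      using covector_elimination[of X Y e] X Y e by blast
    have "x \<notin> separation_set X Y" using X by (simp add: separation_set_def)
    then have "Z x = Zero" using Z(3) assms X Y by (simp add: compose_sv_def)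
    with Z show ?thesis by blast
  qed
  show "r - 1 \<le> card (E - {x})"
    using rank_le_card assms by (auto simp: card_Diff_singleton_if)
  show "card (zero_set (E - {x}) v) < r - 1" if "v \<in> {v \<in> L. v x = Zero}" "v \<noteq> null" for v
  proof -
    have "zero_set E v = insert x (zero_set (E - {x}) v)" using that assms by (auto simp: zero_set_def)
    moreover have "finite (zero_set (E - {x}) v)" "x \<notin> zero_set (E - {x}) v"
      using finite_ground by (auto simp: zero_set_def)
    ultimately show ?thesis using few_zeros[of v] that by simp
  qed
  show "\<exists>v\<in>{v \<in> L. v x = Zero}. v \<noteq> null \<and> (\<forall>e\<in>Z. v e = Zero)"
    if "Z \<subseteq> E - {x}" "card Z + 1 = r - 1" for Z
  proof -
    have "finite Z" "x \<notin> Z" using that finite_ground finite_subset[of Z E] by blast+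
    then show ?thesis using vanishing_covector[of "insert x Z"] that assms by auto
  qed
qed

section \<open>Faces and elimination paths\<close>

text \<open>Among all nonzero covectors with a zero in \<open>F\<close>, one with the fewest separations from \<open>T\<close> in \<open>F\<close> is
conformal to \<open>T\<close>: eliminating one more separation from \<open>T\<close> would produce a better one.\<close>
lemma proper_face_exists:
  assumes "T \<in> L" "F \<subseteq> E" "r \<le> card F" "2 \<le> r" "\<And>e. e \<in> F \<Longrightarrow> T e \<noteq> Zero"
  obtains c x where "c \<in> L" "c \<noteq> null" "x \<in> F" "c x = Zero" "conformal_on F c T"
proof -
  define C where "C = {z \<in> L. z \<noteq> null \<and> (\<exists>x\<in>F. z x = Zero)}"
  have finF: "finite F" using assms(2) finite_ground finite_subset by blast
  have "F \<noteq> {}" using assms(3,4) by auto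
  then obtain x where x: "x \<in> F" by blast
  have "card {x} \<le> r - 1" using assms(4) by simp
  then obtain Z where Z: "{x} \<subseteq> Z" "Z \<subseteq> E" "card Z = r - 1"
    using exists_subset_between[of "{x}" "r - 1" E] rank_le_card finite_ground x assms
    by (metis diff_le_self dual_order.trans empty_subsetI in_mono insert_subset)
  then obtain z0 where "z0 \<in> L" "z0 \<noteq> null" "\<forall>e\<in>Z. z0 e = Zero"
    using vanishing_covector[of Z] assms(4) by auto
  then have "z0 \<in> C" using x Z by (auto simp: C_def)
  then obtain c where c: "c \<in> C" "\<And>z. z \<in> C \<Longrightarrow> card (separation_set T c \<inter> F) \<le> card (separation_set T z \<inter> F)"
    using ex_has_least_nat[of "\<lambda>z. z \<in> C" z0 "\<lambda>z. card (separation_set T z \<inter> F)"] by auto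
  obtain x where x: "x \<in> F" "c x = Zero" using c by (auto simp: C_def)
  have "separation_set T c \<inter> F = {}"
  proof (rule ccontr)
    assume "separation_set T c \<inter> F \<noteq> {}"
    then obtain f where f: "f \<in> F" "T f \<noteq> Zero" "c f = neg_sign (T f)"
      by (auto simp: separation_set_def)
    obtain z where z: "z \<in> L" "z f = Zero"
      "\<And>g. g \<notin> separation_set T c \<Longrightarrow> z g = compose_sv T c g"
      by (rule eliminate[of T c f]) (use assms c f in \<open>auto simp: C_def\<close>)
    have "z x = T x" using z(3)[of x] x assms(5)[of x] by (auto simp: separation_set_def compose_sv_def)
    then have "z \<in> C" using z f x assms(5)[of x] by (auto simp: C_def)
    moreover have "separation_set T z \<inter> F \<subset> separation_set T c \<inter> F"
    proof
      show "separation_set T z \<inter> F \<subseteq> separation_set T c \<inter> F"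
      proof
        fix g assume g: "g \<in> separation_set T z \<inter> F"
        show "g \<in> separation_set T c \<inter> F"
        proof (rule ccontr)
          assume "g \<notin> separation_set T c \<inter> F"
          then have "z g = T g" using z(3)[of g] g assms(5)[of g] by (auto simp: compose_sv_def)
          then show False using g by (auto simp: separation_set_def)
        qed
      qed
      show "separation_set T z \<inter> F \<noteq> separation_set T c \<inter> F"
        proof
        assume "separation_set T z \<inter> F = separation_set T c \<inter> F"
        then have "f \<in> separation_set T z" using f by (auto simp: separation_set_def)
        then show False using f z(2) by (simp add: separation_set_def)
      qed
    qed
    then have "card (separation_set T z \<inter> F) < card (separation_set T c \<inter> F)"
      using finF by (intro psubset_card_mono) auto
    ultimately show False using c(2)[of z] by simp
  qed
  then have "c e \<noteq> neg_sign (T e)" if "e \<in> F" for e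
    using that assms(5)[OF that] by (auto simp: separation_set_def)
  then have "conformal_on F c T"
    unfolding conformal_on_def using nonzero_sign_cases assms(5) by blast
  with c x that show ?thesis by (auto simp: C_def)
qed

text \<open>Conformality is asked for on \<open>F\<close> only. This makes \<open>faces F T\<close> the set of proper faces of \<open>T\<close> in the
restriction to \<open>F\<close>, without a change of the ground set.\<close>
definition faces :: "'a set \<Rightarrow> ('a \<Rightarrow> sign) \<Rightarrow> ('a \<Rightarrow> sign) set" where
  "faces F T = {c \<in> L. c \<noteq> null \<and> conformal_on F c T \<and> (\<exists>x\<in>F. c x = Zero)}"

lemma facesI:
  "c \<in> L \<Longrightarrow> c \<noteq> null \<Longrightarrow> conformal_on F c T \<Longrightarrow> x \<in> F \<Longrightarrow> c x = Zero \<Longrightarrow> c \<in> faces F T"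
  by (auto simp: faces_def)

lemma face_nonzero:
  assumes "c \<in> faces F T" "F' \<subseteq> E" "r \<le> card F'"
  obtains f where "f \<in> F'" "c f \<noteq> Zero"
  using null_if_many_zeros[of c F'] assms by (auto simp: faces_def)

text \<open>Two faces with a common zero \<open>x\<close> that lie on opposite sides of the wall of a new element \<open>e\<close> yield, by
elimination of \<open>e\<close>, a face on that wall that still vanishes at \<open>x\<close>.\<close>
lemma face_on_wall:
  assumes c: "c \<in> faces F T" "c' \<in> faces F T" and x: "x \<in> insert e F" "c x = Zero" "c' x = Zero"
    and e: "c e \<noteq> Zero" "c' e = neg_sign (c e)" and F: "F \<subseteq> E" "r \<le> card F" "\<And>f. f \<in> F \<Longrightarrow> T f \<noteq> Zero"
  obtains n where "n \<in> faces (insert e F) T" "n e = Zero" "n x = Zero"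
proof -
  obtain n where n: "n \<in> L" "n e = Zero"
    "\<And>f. f \<notin> separation_set c c' \<Longrightarrow> n f = compose_sv c c' f"
    by (rule eliminate[of c c' e]) (use c e in \<open>auto simp: faces_def\<close>)
  have sep: "f \<notin> separation_set c c'" if "f \<in> F" for f
  proof -
    have "c f = Zero \<or> c f = T f" "c' f = Zero \<or> c' f = T f"
      using c that by (auto simp: faces_def conformal_on_def)
    then show ?thesis using F(3)[OF that] by (auto simp: separation_set_def)
  qed
  have conf: "conformal_on (insert e F) n T"
    using n(2,3) sep c by (auto simp: faces_def conformal_on_def compose_sv_def)
  obtain f where f: "f \<in> F" "c f \<noteq> Zero" using face_nonzero[OF c(1) F(1,2)] by blast
  have "n f \<noteq> Zero" using n(3)[OF sep[OF f(1)]] f by (auto simp: compose_sv_def)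
  then have "n \<noteq> null" by auto
  moreover have "n x = Zero" using n(2) n(3)[OF sep, of x] x by (auto simp: compose_sv_def)
  ultimately show ?thesis using that[of n] facesI[OF n(1) _ conf, of e] n(2) by blast
qed

text \<open>The boundary of a tope is connected in rank at least three. The property \<open>Q\<close> stands for membership
in a connected component, where two faces are linked by a common zero. The induction is on the size
of \<open>F\<close>. For \<open>r\<close> elements all sign patterns occur, so any two zeros have a common face. When an
element \<open>e\<close> is added, some faces of the smaller arrangement are cut off by the wall of \<open>e\<close>. A path
that leaves and re-enters the good side can be rerouted along the wall, since all faces on it share
the zero \<open>e\<close>.\<close>
lemma faces_connected:
  assumes "3 \<le> r" "F \<subseteq> E" "r \<le> card F" "\<And>e. e \<in> F \<Longrightarrow> T e \<noteq> Zero"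
    and "\<And>c c' x. c \<in> faces F T \<Longrightarrow> c' \<in> faces F T \<Longrightarrow> x \<in> F \<Longrightarrow> c x = Zero \<Longrightarrow> c' x = Zero \<Longrightarrow> Q c \<Longrightarrow> Q c'"
    and "c \<in> faces F T" "c' \<in> faces F T" "Q c"
  shows "Q c'"
proof -
  have "\<forall>F Q c c'. card F = k \<longrightarrow> F \<subseteq> E \<longrightarrow> (\<forall>e\<in>F. T e \<noteq> Zero) \<longrightarrow>
      (\<forall>c c' x. c \<in> faces F T \<longrightarrow> c' \<in> faces F T \<longrightarrow> x \<in> F \<longrightarrow> c x = Zero \<longrightarrow> c' x = Zero \<longrightarrow> Q c \<longrightarrow> Q c') \<longrightarrow>
      c \<in> faces F T \<longrightarrow> c' \<in> faces F T \<longrightarrow> Q c \<longrightarrow> Q c'" if "r \<le> k" for k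
    using that
  proof (induction k rule: dec_induct)
    case base
    show ?case
    proof (intro allI impI)
      fix F Q c c'
      assume F: "card F = r" "F \<subseteq> E" "\<forall>e\<in>F. T e \<noteq> Zero"
        and share: "\<forall>c c' x. c \<in> faces F T \<longrightarrow> c' \<in> faces F T \<longrightarrow> x \<in> F \<longrightarrow> c x = Zero \<longrightarrow>
          c' x = Zero \<longrightarrow> Q c \<longrightarrow> Q c'"
        and c: "c \<in> faces F T" "c' \<in> faces F T" "Q c"
      obtain x y where xy: "x \<in> F" "c x = Zero" "y \<in> F" "c' y = Zero"
        using c by (auto simp: faces_def)
      obtain n where n: "n \<in> L" "\<And>e. e \<in> F \<Longrightarrow> n e = (if e = x \<or> e = y then Zero else T e)"
        by (rule any_signs_on_small_set[of F "\<lambda>e. if e = x \<or> e = y then Zero else T e"]) (use F in auto)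
      have "card {x, y} < card F" using F assms(1) by (cases "x = y") auto
      then have "\<not> F \<subseteq> {x, y}" using card_mono[of "{x, y}" F] by auto
      then obtain z where "z \<in> F" "z \<noteq> x" "z \<noteq> y" by blast
      then have "n z \<noteq> Zero" using n F by auto
      then have "n \<noteq> null" by auto
      then have "n \<in> faces F T" "n x = Zero" "n y = Zero"
        using n xy by (auto simp: faces_def conformal_on_def)
      then show "Q c'" using share c xy by blast
    qed
  next
    case (step k)
    show ?case
    proof (intro allI impI)
      fix F Q c c'
      assume F: "card F = Suc k" "F \<subseteq> E" "\<forall>e\<in>F. T e \<noteq> Zero"
        and share0: "\<forall>c c' x. c \<in> faces F T \<longrightarrow> c' \<in> faces F T \<longrightarrow> x \<in> F \<longrightarrow> c x = Zero \<longrightarrow>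
          c' x = Zero \<longrightarrow> Q c \<longrightarrow> Q c'"
        and c: "c \<in> faces F T" "c' \<in> faces F T" "Q c"
      from share0 have share: "\<And>c c' x. c \<in> faces F T \<Longrightarrow> c' \<in> faces F T \<Longrightarrow> x \<in> F \<Longrightarrow>
        c x = Zero \<Longrightarrow> c' x = Zero \<Longrightarrow> Q c \<Longrightarrow> Q c'" by blast
      have "F \<noteq> {}" using F(1) by auto
      then obtain e where e: "e \<in> F" by blast
      define F' where "F' = F - {e}"
      have F': "F' \<subseteq> E" "card F' = k" "r \<le> card F'" "F = insert e F'" "F' \<subseteq> F" "e \<notin> F'"
        using F e step(1) by (auto simp: F'_def)
      have T': "\<And>f. f \<in> F' \<Longrightarrow> T f \<noteq> Zero" using F F' by auto
      \<comment> \<open>A face on the far side of the wall is represented by the component of the faces on the wall.\<close>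
      define good where "good c \<longleftrightarrow> c e = Zero \<or> c e = T e" for c
      define Q' where "Q' c \<longleftrightarrow> (if good c then Q c else \<exists>n\<in>faces F T. n e = Zero \<and> Q n)" for c
      have good_face: "c \<in> faces F T" if "c \<in> faces F' T" "good c" for c
        using that F' by (auto simp: faces_def conformal_on_def good_def)
      have opposite: "c2 e = neg_sign (c1 e)" if "good c1" "c1 e \<noteq> Zero" "\<not> good c2" for c1 c2
        using that nonzero_sign_cases[of "c1 e" "c2 e"] by (auto simp: good_def)
      have share': "Q' c2" if c1: "c1 \<in> faces F' T" and c2: "c2 \<in> faces F' T"
        and x: "x \<in> F'" "c1 x = Zero" "c2 x = Zero" and Q1: "Q' c1" for c1 c2 x
      proof -
        have xF: "x \<in> F" using x F' by auto
        consider "good c1" "good c2" | "good c1" "\<not> good c2" | "\<not> good c1" "good c2" | "\<not> good c1" "\<not> good c2"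
          by blast
        then show ?thesis
        proof cases
          case 1
          have "c1 \<in> faces F T" "c2 \<in> faces F T" using good_face c1 c2 1 by blast+
          then have "Q c2" using share[of c1 c2 x] xF x(2,3) Q1 1 by (simp add: Q'_def)
          with 1 show ?thesis by (simp add: Q'_def)
        next
          case 2
          then have Q: "Q c1" "c1 \<in> faces F T" using Q1 good_face c1 by (auto simp: Q'_def)
          have "\<exists>n\<in>faces F T. n e = Zero \<and> Q n"
          proof (cases "c1 e = Zero")
            case True
            then show ?thesis using Q by blast
          next
            case False
            obtain n where "n \<in> faces F T" "n e = Zero" "n x = Zero"
              by (rule face_on_wall[OF c1 c2 _ x(2,3) False opposite[OF 2(1) False 2(2)] F'(1,3) T'])
                (use x F' in auto)
            then show ?thesis using share[OF Q(2) _ xF x(2) _ Q(1)] by blast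
          qed
          with 2 show ?thesis by (simp add: Q'_def)
        next
          case 3
          then obtain n where n: "n \<in> faces F T" "n e = Zero" "Q n" using Q1 by (auto simp: Q'_def)
          have c2F: "c2 \<in> faces F T" using good_face c2 3 by blast
          have "Q c2"
          proof (cases "c2 e = Zero")
            case True
            then show ?thesis using share[OF n(1) c2F e n(2) _ n(3)] by blast
          next
            case False
            obtain m where m: "m \<in> faces F T" "m e = Zero" "m x = Zero"
              by (rule face_on_wall[OF c2 c1 _ x(3,2) False opposite[OF 3(2) False 3(1)] F'(1,3) T'])
                (use x F' in auto)
            have "Q m" using share[OF n(1) m(1) e n(2) m(2) n(3)] .
            then show ?thesis using share[OF m(1) c2F xF m(3) x(3)] by blast
          qed
          with 3 show ?thesis by (simp add: Q'_def)
        next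
          case 4
          then show ?thesis using Q1 by (simp add: Q'_def)
        qed
      qed
      \<comment> \<open>A face whose only zero is \<open>e\<close> is replaced by a smaller face in the contraction by \<open>e\<close>.\<close>
      have reach: "\<exists>b\<in>faces F' T. b \<in> faces F T \<and> (\<exists>x\<in>F. a x = Zero \<and> b x = Zero)"
        if a: "a \<in> faces F T" for a
      proof (cases "\<exists>x\<in>F'. a x = Zero")
        case True
        then show ?thesis using a F' by (auto simp: faces_def conformal_on_def intro!: bexI[of _ a])
      next
        case False
        then have ae: "a e = Zero" using a F' by (auto simp: faces_def)
        interpret contr: uniform_om "E - {e}" "{v \<in> L. v e = Zero}" "r - 1"
          using contraction e F assms(1) by auto
        obtain b y where b: "b \<in> {v \<in> L. v e = Zero}" "b \<noteq> null" "y \<in> F'" "b y = Zero"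
          "conformal_on F' b a"
          by (rule contr.proper_face_exists[of a F']) (use a ae F' False assms(1) in \<open>auto simp: faces_def\<close>)
        have "conformal_on F' a T" using a F' by (auto simp: faces_def conformal_on_def)
        then have "conformal_on F' b T" using b(5) unfolding conformal_on_def by metis
        then have "b \<in> faces F' T" "b \<in> faces F T" using b F' by (auto simp: faces_def conformal_on_def)
        then show ?thesis using ae b e by auto
      qed
      obtain b x where b: "b \<in> faces F' T" "b \<in> faces F T" "x \<in> F" "c x = Zero" "b x = Zero"
        using reach[OF c(1)] by blast
      obtain b' x' where b': "b' \<in> faces F' T" "b' \<in> faces F T" "x' \<in> F" "c' x' = Zero" "b' x' = Zero"
        using reach[OF c(2)] by blast
      have gd: "good b" "good b'" using b b' e by (auto simp: faces_def conformal_on_def good_def)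
      have "Q b" using share[OF c(1) b(2,3,4,5) c(3)] .
      then have "Q' b" using gd by (simp add: Q'_def)
      moreover have "card F' = k \<longrightarrow> F' \<subseteq> E \<longrightarrow> (\<forall>e\<in>F'. T e \<noteq> Zero) \<longrightarrow>
          (\<forall>c c' x. c \<in> faces F' T \<longrightarrow> c' \<in> faces F' T \<longrightarrow> x \<in> F' \<longrightarrow> c x = Zero \<longrightarrow> c' x = Zero \<longrightarrow>
            Q' c \<longrightarrow> Q' c') \<longrightarrow>
          b \<in> faces F' T \<longrightarrow> b' \<in> faces F' T \<longrightarrow> Q' b \<longrightarrow> Q' b'"
        using step.IH by blast
      ultimately have "Q' b'" using F'(1,2) T' share' b(1) b'(1) by blast
      then have "Q b'" using gd by (simp add: Q'_def)
      then show "Q c'" using share[OF b'(2) c(2) b'(3,5,4)] by blast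
    qed
  qed
  from this[OF assms(3)] have "card F = card F \<longrightarrow> F \<subseteq> E \<longrightarrow> (\<forall>e\<in>F. T e \<noteq> Zero) \<longrightarrow>
      (\<forall>c c' x. c \<in> faces F T \<longrightarrow> c' \<in> faces F T \<longrightarrow> x \<in> F \<longrightarrow> c x = Zero \<longrightarrow> c' x = Zero \<longrightarrow> Q c \<longrightarrow> Q c') \<longrightarrow>
      c \<in> faces F T \<longrightarrow> c' \<in> faces F T \<longrightarrow> Q c \<longrightarrow> Q c'" by blast
  then show ?thesis using assms(2,4-8) by blast
qed

text \<open>Convex sets of covectors are connected: eliminate one separating element \<open>e\<close> to get \<open>Z\<close>, and fill the
zeros of \<open>Z\<close> from \<open>A\<close> and from \<open>C\<close>. Both compositions lie above \<open>Z\<close> and are separated from \<open>A\<close> and \<open>C\<close>,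
respectively, by fewer elements. The predicate \<open>G\<close> describes the region in which the path must stay and \<open>B\<close> a
union of components of that region.\<close>
lemma elimination_path_agreeing:
  assumes step: "\<And>u w. u \<in> L \<Longrightarrow> w \<in> L \<Longrightarrow> G u \<Longrightarrow> G w \<Longrightarrow> conformal_on UNIV u w \<Longrightarrow> u \<in> B \<longleftrightarrow> w \<in> B"
    and "A \<in> L" "C \<in> L" "\<And>f. f \<notin> separation_set A C \<Longrightarrow> A f = C f"
    and "\<And>W. W \<in> L \<Longrightarrow> (\<And>f. f \<notin> separation_set A C \<Longrightarrow> W f = A f) \<Longrightarrow> G W"
  shows "A \<in> B \<longleftrightarrow> C \<in> B"
  using assms(2-5)
proof (induction "card (separation_set A C)" arbitrary: A C rule: less_induct)
  case less
  have fin: "finite (separation_set A C)"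
    by (rule finite_subset[OF _ finite_ground])
      (use zero_off_ground less.prems(1) in \<open>auto simp: separation_set_def\<close>)
  show ?case
  proof (cases "separation_set A C = {}")
    case True
    then have "A = C" using less.prems(3) by auto
    then show ?thesis by simp
  next
    case False
    then obtain e where e: "e \<in> separation_set A C" by blast
    obtain Z where Z: "Z \<in> L" "Z e = Zero"
      "\<And>f. f \<notin> separation_set A C \<Longrightarrow> Z f = compose_sv A C f"
      by (rule eliminate[of A C e]) (use less.prems(1,2) e in \<open>auto simp: separation_set_def\<close>)
    have ZA: "Z f = A f" if "f \<notin> separation_set A C" for f
      using Z(3)[OF that] less.prems(3)[OF that] by (auto simp: compose_sv_def)
    have half: "X \<in> B \<longleftrightarrow> Z \<in> B"
      if X: "X \<in> L" and XA: "\<And>f. f \<notin> separation_set A C \<Longrightarrow> X f = A f"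
        and Xn: "\<And>f. f \<in> separation_set A C \<Longrightarrow> X f \<noteq> Zero" for X
    proof -
      define Y where "Y = compose_sv Z X"
      have Y: "Y \<in> L" using compose_covector Z X by (simp add: Y_def)
      have YA: "Y f = A f" if "f \<notin> separation_set A C" for f
        using ZA XA that by (auto simp: Y_def compose_sv_def)
      have sub: "separation_set X Y \<subseteq> separation_set A C - {e}"
      proof
        fix g assume g: "g \<in> separation_set X Y"
        have "g \<in> separation_set A C"
          using g YA[of g] XA[of g] by (cases "g \<in> separation_set A C") (auto simp: separation_set_def)
        moreover have "g \<noteq> e" using g Z(2) by (auto simp: separation_set_def Y_def compose_sv_def)
        ultimately show "g \<in> separation_set A C - {e}" by simp
      qed
      have "X \<in> B \<longleftrightarrow> Y \<in> B"
      proof (rule less.hyps)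
        have "separation_set X Y \<subset> separation_set A C" using sub e by blast
        then show "card (separation_set X Y) < card (separation_set A C)"
          using fin by (rule psubset_card_mono[rotated])
        show "X f = Y f" if "f \<notin> separation_set X Y" for f
        proof (cases "f \<in> separation_set A C")
          case True
          then show ?thesis
            using Xn[OF True] that nonzero_sign_cases[of "X f" "Z f"]
            by (auto simp: Y_def compose_sv_def separation_set_def split: if_splits)
        next
          case False
          then show ?thesis using XA YA by simp
        qed
        show "G W" if "W \<in> L" "\<And>f. f \<notin> separation_set X Y \<Longrightarrow> W f = X f" for W
        proof (rule less.prems(4)[OF that(1)])
          fix f assume f: "f \<notin> separation_set A C"
          then have "f \<notin> separation_set X Y" using sub by blast
          then show "W f = A f" using that(2) XA[OF f] by simp
        qed
      qed (use X Y in auto)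
      moreover have "Z \<in> B \<longleftrightarrow> Y \<in> B"
      proof (rule step)
        show "G Z" "G Y" using less.prems(4)[OF Z(1) ZA] less.prems(4)[OF Y YA] by simp_all
        show "conformal_on UNIV Z Y" by (auto simp: conformal_on_def Y_def compose_sv_def)
      qed (use Z Y in auto)
      ultimately show ?thesis by simp
    qed
    have "A \<in> B \<longleftrightarrow> Z \<in> B"
      by (rule half) (use less.prems(1) in \<open>auto simp: separation_set_def\<close>)
    moreover have "C \<in> B \<longleftrightarrow> Z \<in> B"
    proof (rule half)
      show "C f = A f" if "f \<notin> separation_set A C" for f using less.prems(3)[OF that] by simp
    qed (use less.prems(2) in \<open>auto simp: separation_set_def\<close>)
    ultimately show ?thesis by simp
  qed
qed

lemma elimination_path:
  assumes step: "\<And>u w. u \<in> L \<Longrightarrow> w \<in> L \<Longrightarrow> G u \<Longrightarrow> G w \<Longrightarrow> conformal_on UNIV u w \<Longrightarrow> u \<in> B \<longleftrightarrow> w \<in> B"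
    and "u \<in> L" "w \<in> L" "G u" "G w"
    and between: "\<And>W. W \<in> L \<Longrightarrow> (\<And>f. f \<notin> separation_set u w \<Longrightarrow> W f = compose_sv u w f) \<Longrightarrow> G W"
  shows "u \<in> B \<longleftrightarrow> w \<in> B"
proof -
  define A where "A = compose_sv u w"
  define C where "C = compose_sv w u"
  have AC: "A \<in> L" "C \<in> L" using assms compose_covector by (auto simp: A_def C_def)
  have sep: "separation_set A C = separation_set u w"
    by (auto simp: A_def C_def compose_sv_def separation_set_def split: if_splits)
  have same: "A f = C f" if "f \<notin> separation_set u w" for f
    using that nonzero_sign_cases[of "u f" "w f"]
    by (auto simp: A_def C_def compose_sv_def separation_set_def)
  have "G A" by (rule between[OF AC(1)]) (simp add: A_def)
  have "G C" by (rule between[OF AC(2)]) (simp add: A_def same[symmetric])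
  have "A \<in> B \<longleftrightarrow> C \<in> B"
  proof (rule elimination_path_agreeing[of G, OF step AC])
    show "A f = C f" if "f \<notin> separation_set A C" for f using same that by (simp add: sep)
    show "G W" if "W \<in> L" "\<And>f. f \<notin> separation_set A C \<Longrightarrow> W f = A f" for W
      using between[OF that(1)] that(2)[unfolded sep] by (simp add: A_def)
  qed
  moreover have "u \<in> B \<longleftrightarrow> A \<in> B"
    by (rule step[OF assms(2) AC(1) assms(4) \<open>G A\<close>]) (auto simp: A_def conformal_on_def compose_sv_def)
  moreover have "w \<in> B \<longleftrightarrow> C \<in> B"
    by (rule step[OF assms(3) AC(2) assms(5) \<open>G C\<close>]) (auto simp: C_def conformal_on_def compose_sv_def)
  ultimately show ?thesis by simp
qed

lemma vertex_entries:
  assumes "v \<in> L" "v \<noteq> null" "R \<subseteq> E" "card R + 3 = r" "p \<in> E - R" "q \<in> E - R" "p \<noteq> q"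
    "\<And>f. f \<in> R \<Longrightarrow> v f = Zero" "v p = Zero" "v q = Zero" "f \<in> E - R" "f \<noteq> p" "f \<noteq> q"
  shows "v f \<noteq> Zero"
proof -
  have "finite R" using finite_subset[OF assms(3) finite_ground] .
  then have "card (insert p (insert q R)) + 1 = r" using assms by simp
  then show ?thesis
    using nonzero_off_zeros[OF assms(1,2), of "insert p (insert q R)" f] assms by auto
qed

text \<open>Consistency around a quadrilateral. The covectors \<open>a\<close>, \<open>b\<close>, \<open>c\<close>, \<open>e\<close> vanish at \<open>R\<close> and at one element
of each of the pairs \<open>{x, x'}\<close> and \<open>{y, y'}\<close>. Neighbors exchange one zero for another and have opposite
signs there, each at the zero of the other. If this rule failed on the fourth side only, eliminating
\<open>x'\<close> from \<open>a\<close> and \<open>\<plusminus>e\<close>, and \<open>x\<close> from \<open>b\<close> and \<open>\<plusminus>c\<close>, would give two covectors with the \<open>r - 1\<close> zeros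
\<open>R\<close>, \<open>x\<close>, \<open>x'\<close> that are neither equal nor opposite.\<close>
lemma square_signs:
  assumes R: "R \<subseteq> E" "card R + 3 = r"
    and pts: "x \<in> E - R" "x' \<in> E - R" "y \<in> E - R" "y' \<in> E - R" "distinct [x, x', y, y']"
    and L: "a \<in> L" "b \<in> L" "c \<in> L" "e \<in> L"
    and R0: "\<And>f. f \<in> R \<Longrightarrow> a f = Zero \<and> b f = Zero \<and> c f = Zero \<and> e f = Zero"
    and z: "a x = Zero" "a y = Zero" "b x' = Zero" "b y = Zero" "c x' = Zero" "c y' = Zero"
      "e x = Zero" "e y' = Zero"
    and s: "a \<noteq> null" "b x = neg_sign (a x')" "c y = neg_sign (b y')" "e x' = neg_sign (c x)"
  shows "e y = neg_sign (a y')"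
proof (rule ccontr)
  assume no: "e y \<noteq> neg_sign (a y')"
  have a: "a x' \<noteq> Zero" "a y' \<noteq> Zero"
    using vertex_entries[OF L(1) s(1) R pts(1,3)] pts R0 z by auto
  then have "b \<noteq> null" using s by auto
  then have b: "b x \<noteq> Zero" "b y' \<noteq> Zero"
    using vertex_entries[OF L(2) _ R pts(2,3)] pts R0 z by auto
  then have "c \<noteq> null" using s by auto
  then have c: "c x \<noteq> Zero" "c y \<noteq> Zero"
    using vertex_entries[OF L(3) _ R pts(2,4)] pts R0 z by auto
  then have "e \<noteq> null" using s by auto
  then have e: "e x' \<noteq> Zero" "e y \<noteq> Zero"
    using vertex_entries[OF L(4) _ R pts(1,4)] pts R0 z by auto
  have m: "e y = a y'" using nonzero_sign_cases[OF a(2) e(2)] no by blast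
  have combine: False
    if L': "c' \<in> L" "e' \<in> L" and R': "\<And>f. f \<in> R \<Longrightarrow> c' f = Zero \<and> e' f = Zero"
      and z': "c' x' = Zero" "c' y' = Zero" "e' x = Zero" "e' y' = Zero"
      and t: "c' x = a x'" "e' x' = neg_sign (a x')" and neq: "(e' y = a y') = (c' y \<noteq> b y')"
      and nz: "c' y \<noteq> Zero" "e' y \<noteq> Zero" for c' e'
  proof -
    obtain f where f: "f \<in> L" "f x' = Zero"
      "\<And>g. g \<notin> separation_set a e' \<Longrightarrow> f g = compose_sv a e' g"
      using eliminate[OF L(1) L'(2) a(1) t(2)] by blast
    obtain f' where f': "f' \<in> L" "f' x = Zero"
      "\<And>g. g \<notin> separation_set b c' \<Longrightarrow> f' g = compose_sv b c' g"
      using eliminate[OF L(2) L'(1) b(1)] t(1) s(2) by auto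
    have fv: "f x = Zero" "f y = e' y" "f y' = a y'" "\<And>g. g \<in> R \<Longrightarrow> f g = Zero"
      using f(3)[of x] f(3)[of y] f(3)[of y'] f(3) z z' R0 R' a(2) nz
      by (auto simp: separation_set_def compose_sv_def)
    have f'v: "f' x' = Zero" "f' y = c' y" "f' y' = b y'" "\<And>g. g \<in> R \<Longrightarrow> f' g = Zero"
      using f'(3)[of x'] f'(3)[of y] f'(3)[of y'] f'(3) z z' R0 R' b(2) nz
      by (auto simp: separation_set_def compose_sv_def)
    have "finite R" using finite_subset[OF R(1) finite_ground] .
    then have card: "card (insert x (insert x' R)) + 1 = r" using pts R by simp
    have "f \<noteq> null" "f' \<noteq> null" using fv(2) f'v(2) nz by auto
    then have "f' = f \<or> f' = opp f"
      using cocircuit_unique_opp[OF f(1) f'(1) _ card] R pts f(2) f'(2) fv f'v by auto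
    then have "(f' y = f y) = (f' y' = f y')" using nz a(2) fv f'v by auto
    then show False using fv f'v neq nz a(2) b(2) nonzero_sign_cases[of "a y'" "e' y"]
      nonzero_sign_cases[of "a y'" "b y'"] nonzero_sign_cases[of "a y'" "c' y"] by auto
  qed
  show False
  proof (cases "c x = a x'")
    case True
    show False by (rule combine[of c e]) (use True L R0 z s m c e a b in auto)
  next
    case False
    then have "c x = neg_sign (a x')" using nonzero_sign_cases[OF a(1) c(1)] by blast
    then show False
      by (intro combine[of "opp c" "opp e"]) (use L neg_covector R0 z s m c e a b in auto)
  qed
qed

end

section \<open>Colors and mixed covectors\<close>

text \<open>A zero on a class counts as meeting its convex hull, so mixedness passes to smaller nonzero
covectors, and a covector that vanishes once on every class is mixed.\<close>
definition mixed :: "nat set \<Rightarrow> (nat \<Rightarrow> 'a set) \<Rightarrow> ('a \<Rightarrow> sign) \<Rightarrow> bool" where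
  "mixed I P u \<longleftrightarrow> u \<noteq> null \<and> (\<forall>i\<in>I. \<forall>s. s \<noteq> Zero \<longrightarrow> (\<exists>e\<in>P i. u e \<noteq> s))"

text \<open>An invariant set is a union of connected components of the mixed covectors, where comparable
covectors are adjacent. Quantifying over invariant sets replaces explicit paths.\<close>
definition invariant ::
    "('a \<Rightarrow> sign) set \<Rightarrow> nat set \<Rightarrow> (nat \<Rightarrow> 'a set) \<Rightarrow> ('a \<Rightarrow> sign) set \<Rightarrow> bool" where
  "invariant L I P B \<longleftrightarrow> (\<forall>u\<in>L. \<forall>w\<in>L. mixed I P u \<longrightarrow> mixed I P w \<longrightarrow>
    conformal_on UNIV u w \<longrightarrow> (u \<in> B \<longleftrightarrow> w \<in> B))"

definition orientation ::
    "('a \<Rightarrow> sign) set \<Rightarrow> nat set \<Rightarrow> (nat \<Rightarrow> 'a set) \<Rightarrow> ('a \<Rightarrow> sign) set \<Rightarrow> bool" where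
  "orientation L I P A \<longleftrightarrow> invariant L I P A \<and> (\<forall>u\<in>L. mixed I P u \<longrightarrow> (opp u \<in> A \<longleftrightarrow> u \<notin> A))"

definition separated :: "('a \<Rightarrow> sign) set \<Rightarrow> nat set \<Rightarrow> (nat \<Rightarrow> 'a set) \<Rightarrow> bool" where
  "separated L I P \<longleftrightarrow>
    (\<forall>s. (\<forall>i\<in>I. s i \<noteq> Zero) \<longrightarrow> (\<exists>v\<in>L. \<forall>i\<in>I. \<forall>e\<in>P i. v e = s i))"

text \<open>For \<open>s \<noteq> Zero\<close>, no sign at \<open>e\<close> opposes \<open>s\<close> and at least one equals it, so that
\<open>compose_sv u w\<close> and the covectors obtained by eliminating between \<open>u\<close> and \<open>w\<close> have sign \<open>s\<close> at \<open>e\<close>.\<close>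
definition jointly :: "sign \<Rightarrow> ('a \<Rightarrow> sign) \<Rightarrow> ('a \<Rightarrow> sign) \<Rightarrow> 'a \<Rightarrow> bool" where
  "jointly s u w e \<longleftrightarrow> u e = s \<and> w e \<noteq> neg_sign s \<or> w e = s \<and> u e \<noteq> neg_sign s"

lemma compose_jointly:
  assumes "jointly s u w e" "s \<noteq> Zero"
  shows "e \<notin> separation_set u w" "compose_sv u w e = s"
  using assms nonzero_sign_cases[OF assms(2), of "u e"]
  by (auto simp: jointly_def separation_set_def compose_sv_def)

lemma mixedD: "mixed I P u \<Longrightarrow> i \<in> I \<Longrightarrow> s \<noteq> Zero \<Longrightarrow> \<exists>e\<in>P i. u e \<noteq> s"
  by (simp add: mixed_def)

lemma mixed_opp [simp]: "mixed I P (opp u) \<longleftrightarrow> mixed I P u"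
proof -
  have *: "mixed I P (opp u)" if "mixed I P u" for u :: "'a \<Rightarrow> sign"
  proof -
    have "\<exists>e\<in>P i. opp u e \<noteq> s" if "i \<in> I" "s \<noteq> Zero" for i s
    proof -
      have "neg_sign s \<noteq> Zero" using that by simp
      then obtain e where "e \<in> P i" "u e \<noteq> neg_sign s"
        using mixedD[OF \<open>mixed I P u\<close> \<open>i \<in> I\<close> \<open>neg_sign s \<noteq> Zero\<close>] by blast
      then show ?thesis by (metis neg_neg_sign)
    qed
    then show ?thesis using that by (simp add: mixed_def)
  qed
  from *[of u] *[of "opp u"] show ?thesis by auto
qed

lemma mixedI:
  assumes "u \<noteq> null"
    and "\<And>i. i \<in> I \<Longrightarrow> (\<exists>x\<in>P i. u x = Zero) \<or>
      (\<exists>s p q. s \<noteq> Zero \<and> p \<in> P i \<and> q \<in> P i \<and> u p = s \<and> u q = neg_sign s)"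
  shows "mixed I P u"
  unfolding mixed_def
proof (intro conjI ballI allI impI)
  fix i s assume "i \<in> I" "s \<noteq> Zero"
  then show "\<exists>e\<in>P i. u e \<noteq> s" using assms(2)[of i] by (metis neg_sign_eq_iff(6))
qed (use assms in auto)

lemma colorful_mixed:
  assumes "u \<noteq> null" "\<And>i. i \<in> I \<Longrightarrow> t i \<in> P i" "\<And>i. i \<in> I \<Longrightarrow> u (t i) = Zero"
  shows "mixed I P u"
  by (rule mixedI[OF assms(1)]) (use assms(2,3) in blast)

lemma mixed_both_signs:
  assumes "mixed I P u" "i \<in> I" "\<And>x. x \<in> P i \<Longrightarrow> u x \<noteq> Zero"
  obtains p q where "p \<in> P i" "q \<in> P i" "u p = Plus" "u q = Minus"
proof -
  obtain p q where "p \<in> P i" "u p \<noteq> Minus" "q \<in> P i" "u q \<noteq> Plus"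
    using mixedD[OF assms(1,2), of Plus] mixedD[OF assms(1,2), of Minus] by auto
  then show ?thesis using that assms(3) sign.exhaust by metis
qed

lemma mixed_face:
  assumes "mixed I P u" "\<And>i. i \<in> I \<Longrightarrow> conformal_on (P i) c u" "c \<noteq> null"
  shows "mixed I P c"
  unfolding mixed_def
proof (intro conjI ballI allI impI)
  fix i and s :: sign assume "i \<in> I" "s \<noteq> Zero"
  then obtain e where "e \<in> P i" "u e \<noteq> s" using mixedD[OF assms(1)] by blast
  then show "\<exists>e\<in>P i. c e \<noteq> s"
    using assms(2)[OF \<open>i \<in> I\<close>] \<open>s \<noteq> Zero\<close> by (auto simp: conformal_on_def intro!: bexI[of _ e])
qed (use assms in auto)

lemma mixed_contraction:
  assumes "i \<in> I" "x \<in> P i" "u x = Zero"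
  shows "mixed (I - {i}) P u \<longleftrightarrow> mixed I P u"
proof
  assume "mixed (I - {i}) P u"
  then have *: "u \<noteq> null" "\<And>j s. j \<in> I \<Longrightarrow> j \<noteq> i \<Longrightarrow> s \<noteq> Zero \<Longrightarrow> \<exists>e\<in>P j. u e \<noteq> s"
    by (simp_all add: mixed_def)
  have "\<exists>e\<in>P j. u e \<noteq> s" if "j \<in> I" "s \<noteq> Zero" for j s
    using *(2)[OF that(1) _ that(2)] that assms by (cases "j = i") auto
  with * show "mixed I P u" by (simp add: mixed_def)
qed (simp add: mixed_def)

lemma invariant_contraction:
  assumes "invariant L I P B" "i \<in> I" "x \<in> P i"
  shows "invariant {v \<in> L. v x = Zero} (I - {i}) P B"
  using assms mixed_contraction[of i I x P] by (simp add: invariant_def)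

lemma orientation_uminus:
  assumes "orientation L I P A"
  shows "orientation L I P (- A)"
  using assms by (auto simp: orientation_def invariant_def)

text \<open>The classes need not cover \<open>E\<close>: contracting one element of a class removes this color, and the other
elements of the class remain in the ground set without a color.\<close>
locale colored_om = uniform_om E L "Suc (card I)" for E :: "'a set" and L and I :: "nat set" +
  fixes P :: "nat \<Rightarrow> 'a set"
  assumes finite_colors: "finite I"
    and class_nonempty: "i \<in> I \<Longrightarrow> P i \<noteq> {}"
    and class_subset: "i \<in> I \<Longrightarrow> P i \<subseteq> E"
    and class_disjoint: "disjoint_family_on P I"
begin

abbreviation colored :: "'a set" where
  "colored \<equiv> \<Union> (P ` I)"

lemma colored_subset: "colored \<subseteq> E"
  using class_subset by blast

lemma finite_colored: "finite colored"
  using colored_subset finite_ground finite_subset by blast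

lemma color_unique: "i \<in> I \<Longrightarrow> j \<in> I \<Longrightarrow> x \<in> P i \<Longrightarrow> x \<in> P j \<Longrightarrow> i = j"
  using class_disjoint by (auto simp: disjoint_family_on_def)

text \<open>Signs shared by \<open>u\<close> and \<open>w\<close> persist along an elimination path. If they include a common zero or both
signs on every class, the entire path consists of mixed covectors.\<close>
lemma mixed_path:
  assumes inv: "invariant L I P B" and L: "u \<in> L" "w \<in> L" and mixed: "mixed I P u" "mixed I P w"
    and nz: "s0 \<noteq> Zero" "jointly s0 u w f"
    and clash: "\<And>i. i \<in> I \<Longrightarrow> (\<exists>x\<in>P i. u x = Zero \<and> w x = Zero) \<or>
      (\<exists>s p q. s \<noteq> Zero \<and> p \<in> P i \<and> q \<in> P i \<and> jointly s u w p \<and> jointly (neg_sign s) u w q)"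
  shows "u \<in> B \<longleftrightarrow> w \<in> B"
proof (rule elimination_path[of "mixed I P"])
  show "u' \<in> B \<longleftrightarrow> w' \<in> B" if "u' \<in> L" "w' \<in> L" "mixed I P u'" "mixed I P w'" "conformal_on UNIV u' w'"
    for u' w' using inv that by (auto simp: invariant_def)
  fix W assume W: "W \<in> L" "\<And>f. f \<notin> separation_set u w \<Longrightarrow> W f = compose_sv u w f"
  have val: "W g = s" if "jointly s u w g" "s \<noteq> Zero" for g s
    using W(2)[of g] compose_jointly[OF that] by simp
  show "mixed I P W"
  proof (rule mixedI)
    show "W \<noteq> null" using val[OF nz(2,1)] nz(1) by auto
    fix i assume "i \<in> I"
    from clash[OF this] show "(\<exists>x\<in>P i. W x = Zero) \<or>
      (\<exists>s p q. s \<noteq> Zero \<and> p \<in> P i \<and> q \<in> P i \<and> W p = s \<and> W q = neg_sign s)"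
    proof
      assume "\<exists>x\<in>P i. u x = Zero \<and> w x = Zero"
      then obtain x where x: "x \<in> P i" "u x = Zero" "w x = Zero" by blast
      then have "W x = Zero" using W(2)[of x] by (simp add: separation_set_def compose_sv_def)
      with x show ?thesis by blast
    next
      assume "\<exists>s p q. s \<noteq> Zero \<and> p \<in> P i \<and> q \<in> P i \<and> jointly s u w p \<and> jointly (neg_sign s) u w q"
      then obtain s p q where "s \<noteq> Zero" "p \<in> P i" "q \<in> P i" "jointly s u w p" "jointly (neg_sign s) u w q"
        by blast
      then have "W p = s" "W q = neg_sign s" using val[of s p] val[of "neg_sign s" q] by simp_all
      with \<open>s \<noteq> Zero\<close> \<open>p \<in> P i\<close> \<open>q \<in> P i\<close> show ?thesis by blast
    qed
  qed
qed (use L mixed in auto)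

text \<open>Exchanging a zero for another one of the same color: if \<open>a\<close> and \<open>b\<close> have opposite signs at the
exchanged elements, the path between them has both signs on this class.\<close>
lemma adjacent:
  assumes "invariant L I P B" "a \<in> L" "b \<in> L" "i \<in> I" "x \<in> P i" "x' \<in> P i"
    and "\<And>j. j \<in> I \<Longrightarrow> j \<noteq> i \<Longrightarrow> \<exists>e\<in>P j. a e = Zero \<and> b e = Zero"
    and "a x = Zero" "b x' = Zero" "a x' \<noteq> Zero" "b x = neg_sign (a x')"
  shows "a \<in> B \<longleftrightarrow> b \<in> B"
proof (rule mixed_path[OF assms(1-3), of "a x'" x'])
  have z: "\<exists>e\<in>P j. a e = Zero" "\<exists>e\<in>P j. b e = Zero" if "j \<in> I" for j
    using assms(5,6,8,9) assms(7)[OF that] by (cases "j = i"; blast)+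
  have "a \<noteq> null" "b \<noteq> null" using assms by auto
  then show "mixed I P a" "mixed I P b" using z by (auto intro!: mixedI)
  show j: "jointly (a x') a b x'" using assms by (auto simp: jointly_def)
  fix j assume "j \<in> I"
  show "(\<exists>x\<in>P j. a x = Zero \<and> b x = Zero) \<or>
      (\<exists>s p q. s \<noteq> Zero \<and> p \<in> P j \<and> q \<in> P j \<and> jointly s a b p \<and> jointly (neg_sign s) a b q)"
  proof (cases "j = i")
    case True
    have "jointly (neg_sign (a x')) a b x" using assms by (auto simp: jointly_def)
    with j True assms show ?thesis by blast
  next
    case False
    then show ?thesis using assms(7) \<open>j \<in> I\<close> by blast
  qed
qed (use assms in auto)

lemma conformal_connected:
  assumes "invariant L I P B" "mixed I P u" "c \<in> L" "c' \<in> L"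
    and c: "conformal_on (insert f colored) c u" "conformal_on (insert f colored) c' u"
    and f: "c f \<noteq> Zero" and "c' \<noteq> null"
  shows "c \<in> B \<longleftrightarrow> c' \<in> B"
proof (rule mixed_path[OF assms(1,3,4), of "c f" f])
  have cc: "c e = Zero \<or> c e = u e" "c' e = Zero \<or> c' e = u e" if "e \<in> P i" "i \<in> I" for e i
    using c that by (auto simp: conformal_on_def)
  show "mixed I P c" "mixed I P c'"
    by (rule mixed_face[OF assms(2)]; use c f assms(8) in \<open>auto simp: conformal_on_def\<close>)+
  show "jointly (c f) c c' f" using f c by (force simp: jointly_def conformal_on_def)
  fix i assume i: "i \<in> I"
  show "(\<exists>x\<in>P i. c x = Zero \<and> c' x = Zero) \<or>
      (\<exists>s p q. s \<noteq> Zero \<and> p \<in> P i \<and> q \<in> P i \<and> jointly s c c' p \<and> jointly (neg_sign s) c c' q)"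
  proof (cases "\<exists>x\<in>P i. c x = Zero \<and> c' x = Zero")
    case False
    then have "u x \<noteq> Zero" if "x \<in> P i" for x using cc[OF that i] that by auto
    then obtain p q where pq: "p \<in> P i" "q \<in> P i" "u p = Plus" "u q = Minus"
      using mixed_both_signs[OF assms(2) i] by blast
    have "jointly Plus c c' p" using False pq cc[OF pq(1) i] by (auto simp: jointly_def)
    moreover have "jointly Minus c c' q" using False pq cc[OF pq(2) i] by (auto simp: jointly_def)
    ultimately show ?thesis using pq by (intro disjI2 exI[of _ Plus] exI[of _ p] exI[of _ q]) simp
  qed simp
qed (use f in auto)

text \<open>Distinct colors give distinct elements, so a choice of one element per class is a zero set of the
size \<open>r - 1\<close> that determines a covector up to sign.\<close>
lemma transversal_card:
  assumes "\<And>i. i \<in> I \<Longrightarrow> t i \<in> P i"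
  shows "inj_on t I" "card (t ` I) = card I" "t ` I \<subseteq> colored"
proof -
  show "inj_on t I" using color_unique assms by (metis inj_onI)
  then show "card (t ` I) = card I" by (rule card_image)
  show "t ` I \<subseteq> colored" using assms by blast
qed

lemma transversal_exists:
  obtains t where "\<And>i. i \<in> I \<Longrightarrow> t i \<in> P i"
proof -
  have "\<forall>i\<in>I. \<exists>e. e \<in> P i" using class_nonempty by blast
  then show ?thesis using that by metis
qed

lemma extend_to_transversal:
  assumes "\<And>i. i \<in> J \<Longrightarrow> t i \<in> P i"
  obtains t' where "\<And>i. i \<in> I \<Longrightarrow> t' i \<in> P i" "\<And>i. i \<in> J \<Longrightarrow> t' i = t i"
proof -
  obtain g where "\<And>i. i \<in> I \<Longrightarrow> g i \<in> P i" using transversal_exists by blast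
  with assms show ?thesis by (intro that[of "\<lambda>i. if i \<in> J then t i else g i"]) auto
qed

lemma colorful_with_sign:
  assumes "\<And>i. i \<in> I \<Longrightarrow> t i \<in> P i" "f \<in> E" "f \<notin> t ` I" "s \<noteq> Zero"
  obtains v where "v \<in> L" "\<And>i. i \<in> I \<Longrightarrow> v (t i) = Zero" "v f = s"
proof -
  have "t ` I \<subseteq> E" using transversal_card[of t] assms(1) colored_subset by blast
  moreover have "card (t ` I) + 1 = Suc (card I)" using transversal_card(2)[of t] assms(1) by simp
  ultimately obtain v where "v \<in> L" "\<And>e. e \<in> t ` I \<Longrightarrow> v e = Zero" "v f = s"
    using cocircuit_with_sign[of "t ` I" f s] assms(2-4) by metis
  then show ?thesis using that[of v] by blast
qed

lemma colorful_exists: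
  assumes "\<And>i. i \<in> I \<Longrightarrow> t i \<in> P i"
  obtains v where "v \<in> L" "\<And>i. i \<in> I \<Longrightarrow> v (t i) = Zero" "mixed I P v"
proof -
  have "t ` I \<subseteq> E" using transversal_card[of t] assms(1) colored_subset by blast
  then obtain v where v: "v \<in> L" "v \<noteq> null" "\<forall>e\<in>t ` I. v e = Zero"
    using vanishing_covector[of "t ` I"] transversal_card(2)[of t] assms by auto
  have "mixed I P v" by (rule colorful_mixed[OF v(2), of I t]) (use v assms in auto)
  then show ?thesis using that v by auto
qed

lemma contraction_colored:
  assumes "i \<in> I" "x \<in> P i"
  shows "colored_om (E - {x}) {v \<in> L. v x = Zero} (I - {i}) P"
proof -
  have card: "Suc (card (I - {i})) = Suc (card I) - 1"
    using finite_colors assms by (metis card.remove diff_Suc_1)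
  interpret c: uniform_om "E - {x}" "{v \<in> L. v x = Zero}" "Suc (card (I - {i}))"
    unfolding card using contraction[of x] assms class_subset by auto
  show ?thesis
  proof
    show "P j \<subseteq> E - {x}" if "j \<in> I - {i}" for j
      using that class_subset[of j] color_unique[of i j x] assms by auto
    show "disjoint_family_on P (I - {i})" using class_disjoint by (auto simp: disjoint_family_on_def)
  qed (use finite_colors class_nonempty in auto)
qed

lemma separated_contraction:
  assumes "separated L I P" "i \<in> I" "x \<in> P i"
  shows "separated {v \<in> L. v x = Zero} (I - {i}) P"
  unfolding separated_def
proof (intro allI impI)
  fix s :: "nat \<Rightarrow> sign" assume s: "\<forall>j\<in>I - {i}. s j \<noteq> Zero"
  have "\<exists>v\<in>L. \<forall>j\<in>I. \<forall>e\<in>P j. v e = (s(i := \<sigma>)) j" if "\<sigma> \<noteq> Zero" for \<sigma>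
    using assms(1)[unfolded separated_def, rule_format, of "s(i := \<sigma>)"] s that by auto
  from this[of Plus] this[of Minus] obtain v w where vw: "v \<in> L" "w \<in> L"
    "\<forall>j\<in>I. \<forall>e\<in>P j. v e = (s(i := Plus)) j" "\<forall>j\<in>I. \<forall>e\<in>P j. w e = (s(i := Minus)) j" by auto
  obtain z where z: "z \<in> L" "z x = Zero" "\<And>f. f \<notin> separation_set v w \<Longrightarrow> z f = compose_sv v w f"
    by (rule eliminate[of v w x]) (use vw assms in auto)
  have "z e = s j" if "j \<in> I - {i}" "e \<in> P j" for j e
    using z(3)[of e] vw that s by (auto simp: separation_set_def compose_sv_def)
  with z show "\<exists>v\<in>{v \<in> L. v x = Zero}. \<forall>j\<in>I - {i}. \<forall>e\<in>P j. v e = s j" by blast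
qed

text \<open>If the classes are singletons, mixed covectors must vanish at each of them. There are then too few colored
elements for the face arguments, and this case is the start of the inductions.\<close>
lemma mixed_vanish_if_singletons:
  assumes "card colored \<le> card I" "u \<in> L" "mixed I P u" "e \<in> colored"
  shows "u e = Zero"
proof -
  obtain t where t: "\<And>i. i \<in> I \<Longrightarrow> t i \<in> P i"
    using transversal_exists by blast
  have "t ` I = colored"
    using card_subset_eq[OF finite_colored] card_mono[OF finite_colored] transversal_card[of t] t assms(1)
    by (metis le_antisym)
  have single: "P i = {t i}" if i: "i \<in> I" for i
  proof -
    have "e = t i" if e: "e \<in> P i" for e
    proof -
      have "e \<in> t ` I" using \<open>t ` I = colored\<close> e i by blast
      then obtain j where j: "j \<in> I" "e = t j" by blast
      then show ?thesis using color_unique[OF i j(1) e] t[OF j(1)] by simp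
    qed
    then show ?thesis using t[OF i] by blast
  qed
  obtain i where "i \<in> I" "e \<in> P i" using assms by blast
  then have "e = t i" "P i = {t i}" using single[of i] by auto
  then have "u e \<noteq> s" if "s \<noteq> Zero" for s
    using mixedD[OF assms(3) \<open>i \<in> I\<close> that] by auto
  then show ?thesis by blast
qed

lemma mixed_unique_if_singletons:
  assumes "card colored \<le> card I" "u \<in> L" "w \<in> L" "mixed I P u" "mixed I P w"
  shows "w = u \<or> w = opp u"
proof (rule cocircuit_unique_opp[OF assms(2,3) colored_subset])
  obtain t where t: "\<And>i. i \<in> I \<Longrightarrow> t i \<in> P i"
    using transversal_exists by blast
  show "card colored + 1 = Suc (card I)"
    using card_mono[OF finite_colored] transversal_card[of t] t assms(1)
    by (metis Suc_eq_plus1 le_antisym)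
  show "u \<noteq> null" "w \<noteq> null" using assms(4,5) by (simp_all add: mixed_def)
  show "u e = Zero" if "e \<in> colored" for e
    by (rule mixed_vanish_if_singletons[OF assms(1,2,4) that])
  show "w e = Zero" if "e \<in> colored" for e
    by (rule mixed_vanish_if_singletons[OF assms(1,3,5) that])
qed

lemma connected_to_face:
  assumes "Suc (card I) \<le> card colored" "I \<noteq> {}" "u \<in> L" "mixed I P u"
  obtains c i x where "c \<in> L" "mixed I P c" "i \<in> I" "x \<in> P i" "c x = Zero"
    "conformal_on colored c u" "\<forall>B. invariant L I P B \<longrightarrow> (c \<in> B \<longleftrightarrow> u \<in> B)"
proof (cases "\<exists>x\<in>colored. u x = Zero")
  case True
  then show ?thesis using that[of u] assms by (auto simp: conformal_on_def)
next
  case False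
  have "card I \<noteq> 0" using assms(2) finite_colors by simp
  then obtain c x where c: "c \<in> L" "c \<noteq> null" "x \<in> colored" "c x = Zero" "conformal_on colored c u"
    by (rule_tac proper_face_exists[OF assms(3) colored_subset assms(1)]) (use False in auto)
  obtain f where f: "f \<in> colored" "c f \<noteq> Zero"
    using null_if_many_zeros[OF c(1) colored_subset assms(1)] c(2) by blast
  have "mixed I P c"
    by (rule mixed_face[OF assms(4)]) (use c in \<open>auto simp: conformal_on_def\<close>)
  moreover have "c \<in> B \<longleftrightarrow> u \<in> B" if "invariant L I P B" for B
    by (rule conformal_connected[OF that assms(4) c(1) assms(3) _ _ f(2)])
      (use assms(4) c(5) f(1) in \<open>auto simp: conformal_on_def mixed_def\<close>)
  ultimately show ?thesis using that c by blast
qed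

lemma invariant_opp:
  assumes "invariant L I P B"
  shows "invariant L I P {u. opp u \<in> B}"
  unfolding invariant_def
proof (intro ballI impI)
  fix u w assume *: "u \<in> L" "w \<in> L" "mixed I P u" "mixed I P w" "conformal_on UNIV u w"
  have "conformal_on UNIV (opp u) (opp w)" using *(5) by (auto simp: conformal_on_def)
  then have "opp u \<in> B \<longleftrightarrow> opp w \<in> B"
    using assms neg_covector[OF *(1)] neg_covector[OF *(2)] *(3,4) by (simp add: invariant_def)
  then show "u \<in> {u. opp u \<in> B} \<longleftrightarrow> w \<in> {u. opp u \<in> B}" by simp
qed

lemma not_in_transversal:
  assumes "\<And>i. i \<in> I \<Longrightarrow> t i \<in> P i" "i \<in> I" "f \<in> P i" "f \<noteq> t i"
  shows "f \<notin> t ` I"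
proof
  assume "f \<in> t ` I"
  then obtain j where j: "j \<in> I" "f = t j" by blast
  then have "j = i" using color_unique[OF j(1) assms(2), of f] assms(1)[OF j(1)] assms(3) by simp
  with j assms(4) show False by simp
qed

lemma colorful_nonzero:
  assumes "\<And>i. i \<in> I \<Longrightarrow> t i \<in> P i" "v \<in> L" "v \<noteq> null" "\<And>i. i \<in> I \<Longrightarrow> v (t i) = Zero"
    and "i \<in> I" "f \<in> P i" "f \<noteq> t i"
  shows "v f \<noteq> Zero"
proof (rule nonzero_off_zeros[OF assms(2,3)])
  show "t ` I \<subseteq> E" using transversal_card(3)[of t] assms(1) colored_subset by blast
  show "card (t ` I) + 1 = Suc (card I)" using transversal_card(2)[of t] assms(1) by simp
  show "f \<notin> t ` I" using not_in_transversal[of t] assms by blast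
qed (use assms class_subset in auto)

end

text \<open>Up to sign there is only one component of mixed covectors. Both covectors are first moved to faces
that vanish at colored elements \<open>x\<close> and \<open>x'\<close>. If these have different colors, some covector
vanishes at both and connects the contractions by \<open>x\<close> and by \<open>x'\<close>, to which the induction hypothesis
applies. If they have the same color, the bridge is a pair of covectors in which \<open>x\<close> is exchanged for \<open>x'\<close>.\<close>
theorem mixed_connected:
  assumes "colored_om E L I P" "invariant L I P B" "v \<in> L" "w \<in> L" "mixed I P v" "mixed I P w" "v \<in> B"
  shows "w \<in> B \<or> opp w \<in> B"
  using assms
proof (induction "card I" arbitrary: E L I v w rule: less_induct)
  case less
  interpret colored_om E L I P by fact
  note inv = less.prems(2) and L = less.prems(3,4) and mx = less.prems(5,6) and vB = less.prems(7)
  show ?case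
  proof (cases "card colored \<le> card I")
    case True
    then have "w = v \<or> w = opp v" using mixed_unique_if_singletons[OF _ L mx] by blast
    then show ?thesis using vB by auto
  next
    case False
    then have card: "Suc (card I) \<le> card colored" by simp
    then have I: "I \<noteq> {}" by auto
    \<comment> \<open>The induction hypothesis, applied to the contraction by a common zero.\<close>
    have common: "b \<in> B \<or> opp b \<in> B"
      if "a \<in> L" "b \<in> L" "mixed I P a" "mixed I P b" "i \<in> I" "x \<in> P i" "a x = Zero" "b x = Zero"
        "a \<in> B \<or> opp a \<in> B" for a b i x
    proof -
      have "card (I - {i}) < card I" by (rule card_Diff1_less[OF finite_colors that(5)])
      from less.hyps[OF this contraction_colored[OF that(5,6)] invariant_contraction[OF inv that(5,6)]]
      have "b \<in> B \<or> opp b \<in> B" if "a' \<in> {v \<in> L. v x = Zero}" "mixed I P a'" "a' \<in> B" for a'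
        using that mixed_contraction[of i I x P] \<open>i \<in> I\<close> \<open>x \<in> P i\<close> \<open>b \<in> L\<close> \<open>b x = Zero\<close> \<open>mixed I P b\<close>
        by auto
      from this[of a] this[of "opp a"] that neg_covector[of a] show ?thesis by auto
    qed
    obtain c i x where c: "c \<in> L" "mixed I P c" "i \<in> I" "x \<in> P i" "c x = Zero"
      and cv: "\<forall>B. invariant L I P B \<longrightarrow> (c \<in> B \<longleftrightarrow> v \<in> B)"
      by (rule connected_to_face[OF card I L(1) mx(1)], rule that)
    obtain c' i' x' where c': "c' \<in> L" "mixed I P c'" "i' \<in> I" "x' \<in> P i'" "c' x' = Zero"
      and cw: "\<forall>B. invariant L I P B \<longrightarrow> (c' \<in> B \<longleftrightarrow> w \<in> B)"
      by (rule connected_to_face[OF card I L(2) mx(2)], rule that)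
    have cB: "c \<in> B \<or> opp c \<in> B" using cv[rule_format, OF inv] vB by blast
    have "c' \<in> B \<or> opp c' \<in> B"
    proof (cases "i = i'")
      case True
      show ?thesis
      proof (cases "x = x'")
        case True
        then show ?thesis using common[OF c(1) c'(1) c(2) c'(2) c(3,4,5) _ cB] c'(5) by simp
      next
        case False
        obtain t where t: "\<And>k. k \<in> I \<Longrightarrow> t k \<in> P k"
          using transversal_exists by blast
        have tx: "\<And>k. k \<in> I \<Longrightarrow> (t(i := x)) k \<in> P k" "\<And>k. k \<in> I \<Longrightarrow> (t(i := x')) k \<in> P k"
          using t c c' True by auto
        have "x' \<notin> (t(i := x)) ` I" "x \<notin> (t(i := x')) ` I"
          using not_in_transversal[OF tx(1) c(3), of x'] not_in_transversal[OF tx(2) c(3), of x] False c c' True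
          by auto
        moreover have "x \<in> E" "x' \<in> E" using c c' class_subset by blast+
        ultimately obtain a b where
          a: "a \<in> L" "\<And>k. k \<in> I \<Longrightarrow> a ((t(i := x)) k) = Zero" "a x' = Plus" and
          b: "b \<in> L" "\<And>k. k \<in> I \<Longrightarrow> b ((t(i := x')) k) = Zero" "b x = Minus"
          using colorful_with_sign[OF tx(1), of x' Plus] colorful_with_sign[OF tx(2), of x Minus]
          by (metis sign.distinct(1,5))
        have ab: "\<exists>e\<in>P k. a e = Zero \<and> b e = Zero" if "k \<in> I" "k \<noteq> i" for k
          using a(2)[OF that(1)] b(2)[OF that(1)] that(2) t[OF that(1)] by auto
        have ax: "a x = Zero" "b x' = Zero" using a(2)[OF c(3)] b(2)[OF c(3)] by simp_all
        have adj: "a \<in> D \<longleftrightarrow> b \<in> D" if "invariant L I P D" for D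
          by (rule adjacent[OF that a(1) b(1) c(3,4) _ ab ax]) (use a b c' True in auto)
        have "a \<noteq> null" "b \<noteq> null" using a(3) b(3) by auto
        then have mab: "mixed I P a" "mixed I P b"
          using colorful_mixed[OF \<open>a \<noteq> null\<close>, of I "t(i := x)" P] a(2) tx(1)
            colorful_mixed[OF \<open>b \<noteq> null\<close>, of I "t(i := x')" P] b(2) tx(2) by blast+
        have "a \<in> B \<or> opp a \<in> B" by (rule common[OF c(1) a(1) c(2) mab(1) c(3,4,5) ax(1) cB])
        then have "b \<in> B \<or> opp b \<in> B"
          using adj[OF inv] adj[OF invariant_opp[OF inv]] by simp
        then show ?thesis
          using common[OF b(1) c'(1) mab(2) c'(2) c'(3,4) ax(2) c'(5)] by blast
      qed
    next
      case False
      obtain t where t: "\<And>k. k \<in> I \<Longrightarrow> t k \<in> P k"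
        "\<And>k. k \<in> {i, i'} \<Longrightarrow> t k = (if k = i then x else x')"
        by (rule extend_to_transversal[of "{i, i'}" "\<lambda>k. if k = i then x else x'"]) (use c c' in auto)
      obtain m where m: "m \<in> L" "\<And>k. k \<in> I \<Longrightarrow> m (t k) = Zero" "mixed I P m"
        using colorful_exists[OF t(1)] by blast
      have mx: "m x = Zero" "m x' = Zero"
        using m(2)[OF c(3)] m(2)[OF c'(3)] t(2)[of i] t(2)[of i'] False by auto
      have "m \<in> B \<or> opp m \<in> B" by (rule common[OF c(1) m(1) c(2) m(3) c(3,4,5) mx(1) cB])
      then show ?thesis using common[OF m(1) c'(1) m(3) c'(2) c'(3,4) mx(2) c'(5)] by blast
    qed
    then show ?thesis using cw[rule_format, OF inv] cw[rule_format, OF invariant_opp[OF inv]] by simp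
  qed
qed

section \<open>Orienting the mixed covectors\<close>

definition agree where
  "agree L I P x y X Y \<longleftrightarrow>
    (\<forall>u\<in>L. mixed I P u \<longrightarrow> u x = Zero \<longrightarrow> u y = Zero \<longrightarrow> (u \<in> X \<longleftrightarrow> u \<in> Y))"

text \<open>The covectors and colors in the definition are those of the contraction by \<open>x\<close>, an element of color \<open>i\<close>.\<close>
abbreviation link_orientation where
  "link_orientation L I P i x X \<equiv> orientation {v \<in> L. v x = Zero} (I - {i}) P X"

lemma agree_sym: "agree L I P x y X Y \<longleftrightarrow> agree L I P y x Y X"
  by (auto simp: agree_def)

lemma agreeD: "agree L I P x y X Y \<Longrightarrow> u \<in> L \<Longrightarrow> mixed I P u \<Longrightarrow> u x = Zero \<Longrightarrow> u y = Zero \<Longrightarrow> u \<in> X \<longleftrightarrow> u \<in> Y"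
  by (auto simp: agree_def)

lemma conformal_opp_impossible:
  "conformal_on UNIV u (opp u) \<Longrightarrow> u = null"
  "conformal_on UNIV (opp u) u \<Longrightarrow> u = null"
  by (auto simp: conformal_on_def)

context colored_om
begin

lemma orientation_if_singletons:
  assumes "card colored \<le> card I"
  shows "\<exists>A. orientation L I P A"
proof -
  obtain t where t: "\<And>k. k \<in> I \<Longrightarrow> t k \<in> P k"
    using transversal_exists by blast
  obtain v where v: "v \<in> L" "mixed I P v" using colorful_exists[OF t] by blast
  then have vn: "v \<noteq> null" by (simp add: mixed_def)
  then have "opp v \<noteq> v" by (auto simp: fun_eq_iff)
  have uv: "u = v \<or> u = opp v" if "u \<in> L" "mixed I P u" for u
    using mixed_unique_if_singletons[OF assms v(1) that(1) v(2) that(2)] .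
  have "orientation L I P {v}"
    unfolding orientation_def invariant_def
  proof (intro conjI ballI impI)
    fix u w assume *: "u \<in> L" "w \<in> L" "mixed I P u" "mixed I P w" "conformal_on UNIV u w"
    show "u \<in> {v} \<longleftrightarrow> w \<in> {v}"
      using uv[OF *(1,3)] uv[OF *(2,4)] conformal_opp_impossible[of v] *(5) vn by auto
  next
    fix u assume *: "u \<in> L" "mixed I P u"
    show "opp u \<in> {v} \<longleftrightarrow> u \<notin> {v}" using uv[OF *] \<open>opp v \<noteq> v\<close> by auto
  qed
  then show ?thesis by blast
qed

text \<open>In rank two, some \<open>c\<close> vanishes at one element \<open>x\<close> of the class and is positive on the rest of it.
The wall of \<open>x\<close> then bounds the two arcs of mixed covectors, which can be told apart by their sign at \<open>x\<close>,
with \<open>c\<close> itself added to the arc on which \<open>x\<close> is negative.\<close>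
lemma orientation_one_color:
  assumes "I = {i}" "2 \<le> card (P i)" "separated L I P"
  shows "\<exists>A. orientation L I P A"
proof -
  obtain X where X: "X \<in> L" "\<And>e. e \<in> P i \<Longrightarrow> X e = Plus"
    using assms(3)[unfolded separated_def, rule_format, of "\<lambda>_. Plus"] assms(1) by auto
  obtain c x where c: "c \<in> L" "c \<noteq> null" "x \<in> P i" "c x = Zero" "conformal_on (P i) c X"
    by (rule proper_face_exists[OF X(1), of "P i"]) (use X assms class_subset[of i] in auto)
  have xE: "{x} \<subseteq> E" "card {x} + 1 = Suc (card I)" using c class_subset[of i] assms by auto
  have cP: "c y = Plus" if "y \<in> P i" "y \<noteq> x" for y
  proof -
    have "c y \<noteq> Zero"
      using nonzero_off_zeros[OF c(1,2) xE] c(4) that class_subset[of i] assms(1) by auto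
    then show ?thesis using c(5) X(2)[OF that(1)] that(1) by (auto simp: conformal_on_def)
  qed
  have at_x: "u = c \<or> u = opp c" if "u \<in> L" "mixed I P u" "u x = Zero" for u
    using cocircuit_unique_opp[OF c(1) that(1) xE _ _ c(2)] c(4) that by (auto simp: mixed_def)
  have "opp c \<noteq> c" using c(2) by (auto simp: fun_eq_iff)
  define A where "A = {u. u = c \<or> u x = Minus}"
  have "orientation L I P A"
    unfolding orientation_def invariant_def
  proof (intro conjI ballI impI)
    fix u w assume *: "u \<in> L" "w \<in> L" "mixed I P u" "mixed I P w" "conformal_on UNIV u w"
    have uw: "u e = Zero \<or> u e = w e" for e using *(5) by (simp add: conformal_on_def)
    have w_not: "\<exists>e\<in>P i. w e \<noteq> s" if "s \<noteq> Zero" for s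
      using mixedD[OF *(4) _ that] assms(1) by simp
    consider "u x \<noteq> Zero" | "u = c" | "u = opp c" using at_x[OF *(1,3)] by blast
    then show "u \<in> A \<longleftrightarrow> w \<in> A"
    proof cases
      case 1
      then show ?thesis using uw[of x] c(4) by (auto simp: A_def)
    next
      case 2
      have "w x \<noteq> Plus"
      proof
        assume "w x = Plus"
        then have "w e = Plus" if "e \<in> P i" for e
          using uw[of e] cP[OF that] 2 by (cases "e = x") auto
        then show False using w_not[of Plus] by auto
      qed
      moreover have "w = c" if "w x = Zero"
        using at_x[OF *(2,4) that] *(5) 2 conformal_opp_impossible[of c] c(2) by auto
      ultimately show ?thesis using 2 by (cases "w x") (auto simp: A_def)
    next
      case 3
      have "w x \<noteq> Minus"
      proof
        assume "w x = Minus"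
        then have "w e = Minus" if "e \<in> P i" for e
          using uw[of e] cP[OF that] 3 by (cases "e = x") auto
        then show False using w_not[of Minus] by auto
      qed
      moreover have "w \<noteq> c" using *(5) 3 conformal_opp_impossible[of c] c(2) by auto
      ultimately show ?thesis using 3 \<open>opp c \<noteq> c\<close> c(4) by (auto simp: A_def)
    qed
  next
    fix u assume *: "u \<in> L" "mixed I P u"
    show "opp u \<in> A \<longleftrightarrow> u \<notin> A"
    proof (cases "u x")
      case Zero
      then show ?thesis using at_x[OF * Zero] \<open>opp c \<noteq> c\<close> c(4) by (auto simp: A_def)
    qed (use c(4) in \<open>auto simp: A_def\<close>)
  qed
  then show ?thesis by blast
qed

text \<open>The covectors on which the two orientations agree form an invariant set in the contraction
by \<open>x\<close> and \<open>y\<close>, closed under negation. By connectedness up to sign one of them yields all.\<close>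
lemma agree_from_witness:
  assumes ij: "i \<in> I" "j \<in> I" "i \<noteq> j" and xy: "x \<in> P i" "y \<in> P j"
    and X: "link_orientation L I P i x X" and Y: "link_orientation L I P j y Y"
    and u: "u \<in> L" "mixed I P u" "u x = Zero" "u y = Zero" "u \<in> X \<longleftrightarrow> u \<in> Y"
  shows "agree L I P x y X Y"
proof -
  interpret cx: colored_om "E - {x}" "{v \<in> L. v x = Zero}" "I - {i}" P
    by (rule contraction_colored[OF ij(1) xy(1)])
  define M where "M = {v \<in> {v \<in> L. v x = Zero}. v y = Zero}"
  have col: "colored_om (E - {x} - {y}) M (I - {i} - {j}) P"
    unfolding M_def by (rule cx.contraction_colored) (use ij xy in auto)
  have M': "{v \<in> {v \<in> L. v y = Zero}. v x = Zero} = M" "I - {j} - {i} = I - {i} - {j}"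
    by (auto simp: M_def)
  have invX: "invariant M (I - {i} - {j}) P X"
    unfolding M_def by (rule invariant_contraction) (use X ij xy in \<open>auto simp: orientation_def\<close>)
  have invY: "invariant M (I - {i} - {j}) P Y"
    unfolding M'(1)[symmetric] M'(2)[symmetric]
    by (rule invariant_contraction) (use Y ij xy in \<open>auto simp: orientation_def\<close>)
  define B where "B = {w. w \<in> X \<longleftrightarrow> w \<in> Y}"
  have invB: "invariant M (I - {i} - {j}) P B"
    using invX invY by (simp add: invariant_def B_def)
  have mx: "mixed (I - {i} - {j}) P w \<longleftrightarrow> mixed I P w" "mixed (I - {i}) P w \<longleftrightarrow> mixed I P w"
    "mixed (I - {j}) P w \<longleftrightarrow> mixed I P w" if "w x = Zero" "w y = Zero" for w
    using mixed_contraction[of i I x P w] mixed_contraction[of j I y P w]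
      mixed_contraction[of j "I - {i}" y P w] ij xy that by auto
  show ?thesis
    unfolding agree_def
  proof (intro ballI impI)
    fix w assume w: "w \<in> L" "mixed I P w" "w x = Zero" "w y = Zero"
    have "w \<in> B \<or> opp w \<in> B"
      by (rule mixed_connected[OF col invB, of u w]) (use u w mx in \<open>auto simp: M_def B_def\<close>)
    moreover have "opp w \<in> X \<longleftrightarrow> w \<notin> X" "opp w \<in> Y \<longleftrightarrow> w \<notin> Y"
      using X Y w mx by (auto simp: orientation_def)
    ultimately show "w \<in> X \<longleftrightarrow> w \<in> Y" by (auto simp: B_def)
  qed
qed

lemma mixed_vanishing_at:
  assumes "J \<subseteq> I" "\<And>i. i \<in> J \<Longrightarrow> t i \<in> P i"
  obtains u where "u \<in> L" "mixed I P u" "\<And>i. i \<in> J \<Longrightarrow> u (t i) = Zero"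
proof -
  obtain t' where t': "\<And>i. i \<in> I \<Longrightarrow> t' i \<in> P i" "\<And>i. i \<in> J \<Longrightarrow> t' i = t i"
    using extend_to_transversal[of J t] assms(2) by blast
  obtain u where "u \<in> L" "\<And>i. i \<in> I \<Longrightarrow> u (t' i) = Zero" "mixed I P u"
    using colorful_exists[OF t'(1)] by blast
  then show ?thesis using that[of u] t'(2) assms(1) by (metis subsetD)
qed

lemma matching_link_orientation:
  assumes ij: "i \<in> I" "j \<in> I" "i \<noteq> j" and xy: "x \<in> P i" "y \<in> P j"
    and X: "link_orientation L I P i x X" and Y: "link_orientation L I P j y Y"
  shows "\<exists>Y'. link_orientation L I P j y Y' \<and> agree L I P x y X Y'"
proof -
  obtain u where u: "u \<in> L" "mixed I P u" "\<And>k. k \<in> {i, j} \<Longrightarrow> u (if k = i then x else y) = Zero"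
    by (rule mixed_vanishing_at[of "{i, j}" "\<lambda>k. if k = i then x else y"]) (use ij xy in auto)
  have z: "u x = Zero" "u y = Zero" using u(3)[of i] u(3)[of j] ij by auto
  show ?thesis
  proof (cases "u \<in> X \<longleftrightarrow> u \<in> Y")
    case True
    then show ?thesis using agree_from_witness[OF ij xy X Y u(1,2) z] Y by blast
  next
    case False
    then have "u \<in> X \<longleftrightarrow> u \<in> - Y" by auto
    then show ?thesis
      using agree_from_witness[OF ij xy X orientation_uminus[OF Y] u(1,2) z] orientation_uminus[OF Y] by blast
  qed
qed

lemma agree_trans:
  assumes "i \<in> I" "j \<in> I" "k \<in> I" "i \<noteq> j" "j \<noteq> k" "i \<noteq> k" and xyz: "x \<in> P i" "y \<in> P j" "z \<in> P k"
    and X: "link_orientation L I P i x X" and Z: "link_orientation L I P k z Z"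
    and a: "agree L I P x y X Y" "agree L I P y z Y Z"
  shows "agree L I P x z X Z"
proof -
  define t where "t = (\<lambda>l. if l = i then x else if l = j then y else z)"
  obtain u where u: "u \<in> L" "mixed I P u" "\<And>l. l \<in> {i, j, k} \<Longrightarrow> u (t l) = Zero"
    by (rule mixed_vanishing_at[of "{i, j, k}" t]) (use assms in \<open>auto simp: t_def\<close>)
  have z: "u x = Zero" "u y = Zero" "u z = Zero"
    using u(3)[of i] u(3)[of j] u(3)[of k] assms(4-6) by (auto simp: t_def)
  have "u \<in> X \<longleftrightarrow> u \<in> Z" using agreeD[OF a(1) u(1,2) z(1,2)] agreeD[OF a(2) u(1,2) z(2,3)] by simp
  then show ?thesis
    using agree_from_witness[OF assms(1,3,6) xyz(1,3) X Z u(1,2) z(1,3)] by simp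
qed

text \<open>Agreement on three sides of a quadrilateral with vertices \<open>x\<close>, \<open>y\<close>, \<open>z\<close>, \<open>y0\<close> implies agreement on the
fourth. A witness is carried around: each of the covectors \<open>a\<close>, \<open>b\<close>, \<open>c\<close>, \<open>e\<close> vanishes at the two endpoints of one
side and is joined to the next one by exchanging a zero, and \<open>square_signs\<close> permits the last exchange.\<close>
lemma agree_square:
  assumes ij: "i \<in> I" "j \<in> I" "i \<noteq> j" and xs: "x \<in> P i" "z \<in> P i" "x \<noteq> z"
    and ys: "y \<in> P j" "y0 \<in> P j" "y \<noteq> y0"
    and X: "link_orientation L I P i x X" and Z: "link_orientation L I P i z Z"
    and Y: "link_orientation L I P j y Y" and Y0: "link_orientation L I P j y0 Y0"
    and ag: "agree L I P z y Z Y" "agree L I P z y0 Z Y0" "agree L I P x y0 X Y0"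
  shows "agree L I P x y X Y"
proof -
  obtain t where t: "\<And>k. k \<in> I \<Longrightarrow> t k \<in> P k"
    using transversal_exists by blast
  define T where "T p q = t(i := p, j := q)" for p q
  have T: "\<And>k. k \<in> I \<Longrightarrow> T p q k \<in> P k" if "p \<in> P i" "q \<in> P j" for p q
    using t that ij(3) by (auto simp: T_def)
  have Tij: "T p q i = p" "T p q j = q" for p q using ij(3) by (simp_all add: T_def)
  have in_E: "x \<in> E" "z \<in> E" "y \<in> E" "y0 \<in> E" using ij xs ys class_subset by blast+
  define V where "V p q v \<longleftrightarrow> v \<in> L \<and> v \<noteq> null \<and> (\<forall>k\<in>I. v (T p q k) = Zero)" for p q v
  have exV: "\<exists>v. V p q v \<and> v f = s"
    if pq: "p \<in> P i" "q \<in> P j" and f: "k \<in> I" "f \<in> P k" "f \<noteq> T p q k" "s \<noteq> Zero" for p q f k s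
  proof -
    have "f \<notin> T p q ` I" using not_in_transversal[OF T[OF pq] f(1,2,3)] by simp
    moreover have "f \<in> E" using f class_subset by blast
    ultimately obtain v where "v \<in> L" "\<And>k. k \<in> I \<Longrightarrow> v (T p q k) = Zero" "v f = s"
      using colorful_with_sign[OF T[OF pq] _ _ f(4), of f] by blast
    then show ?thesis using f(4) by (auto simp: V_def)
  qed
  have nz: "v f \<noteq> Zero" if "V p q v" "p \<in> P i" "q \<in> P j" "k \<in> I" "f \<in> P k" "f \<noteq> T p q k" for v p q f k
    using colorful_nonzero[OF T[OF that(2,3)] _ _ _ that(4-6)] that(1) by (auto simp: V_def)
  have Vpq: "v p = Zero" "v q = Zero" if "V p q v" for p q v
    using that ij Tij by (auto simp: V_def)
  obtain a where a: "V x y a" "a z = Plus"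
    using exV[OF xs(1) ys(1) ij(1) xs(2), of Plus] xs(3) Tij by auto
  obtain b where b: "V z y b" "b x = neg_sign (a z)"
    using exV[OF xs(2) ys(1) ij(1) xs(1), of "neg_sign (a z)"] xs(3) Tij a(2) by auto
  have by0: "b y0 \<noteq> Zero" using nz[OF b(1) xs(2) ys(1) ij(2) ys(2)] ys(3) Tij by simp
  obtain c where c: "V z y0 c" "c y = neg_sign (b y0)"
    using exV[OF xs(2) ys(2) ij(2) ys(1), of "neg_sign (b y0)"] ys(3) Tij by0 by auto
  have cx: "c x \<noteq> Zero" using nz[OF c(1) xs(2) ys(2) ij(1) xs(1)] xs(3) Tij by simp
  obtain e where e: "V x y0 e" "e z = neg_sign (c x)"
    using exV[OF xs(1) ys(2) ij(1) xs(2), of "neg_sign (c x)"] xs(3) Tij cx by auto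
  define R where "R = t ` (I - {i, j})"
  have tR: "inj_on t I" using transversal_card(1)[of t] t by blast
  have "card R = card (I - {i, j})"
    unfolding R_def by (rule card_image) (rule inj_on_subset[OF tR], blast)
  moreover have "card (I - {i, j}) + 2 = card I"
    using ij finite_colors card_Diff_subset[of "{i, j}" I] card_mono[of I "{i, j}"] by simp
  ultimately have cardR: "card R + 3 = Suc (card I)" by simp
  have RE: "R \<subseteq> E" using t class_subset by (auto simp: R_def)
  have notR: "f \<notin> R" if "k \<in> {i, j}" "f \<in> P k" for f k
  proof
    assume "f \<in> R"
    then obtain l where l: "l \<in> I" "l \<noteq> i" "l \<noteq> j" "f = t l" by (auto simp: R_def)
    then have "l = k" using color_unique[of l k f] t[OF l(1)] that ij by auto
    with l that(1) show False by auto
  qed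
  have V0: "v f = Zero" if V: "V p q v" and f: "f \<in> R" for p q v f
  proof -
    obtain l where "l \<in> I" "l \<noteq> i" "l \<noteq> j" "f = t l" using f by (auto simp: R_def)
    then show ?thesis using V by (auto simp: V_def T_def)
  qed
  have "x \<noteq> y" "x \<noteq> y0" "z \<noteq> y" "z \<noteq> y0"
    using color_unique[OF ij(1,2)] ij(3) xs ys by blast+
  then have "distinct [x, z, y, y0]" using xs(3) ys(3) by simp
  have "e y = neg_sign (a y0)"
  proof (rule square_signs[OF RE cardR _ _ _ _ \<open>distinct [x, z, y, y0]\<close>])
    show "x \<in> E - R" "z \<in> E - R" "y \<in> E - R" "y0 \<in> E - R" using in_E notR xs ys by auto
    show "a \<in> L" "b \<in> L" "c \<in> L" "e \<in> L" "a \<noteq> null" using a b c e by (auto simp: V_def)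
    show "a f = Zero \<and> b f = Zero \<and> c f = Zero \<and> e f = Zero" if "f \<in> R" for f
      using V0[OF a(1) that] V0[OF b(1) that] V0[OF c(1) that] V0[OF e(1) that] by simp
  qed (use Vpq[OF a(1)] Vpq[OF b(1)] Vpq[OF c(1)] Vpq[OF e(1)] b(2) c(2) e(2) in auto)
  have ay0: "a y0 \<noteq> Zero" using nz[OF a(1) xs(1) ys(1) ij(2) ys(2)] ys(3) Tij by simp
  have common: "\<exists>f\<in>P k. v f = Zero \<and> w f = Zero"
    if "V p q v" "V p' q' w" "k \<in> I" "k \<noteq> i" "k \<noteq> j" for p q p' q' v w k
    using that t[OF that(3)] by (auto simp: V_def T_def intro!: bexI[of _ "t k"])
  have link_inv: "invariant {v \<in> L. v f = Zero} (I - {k}) P W"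
    if "link_orientation L I P k f W" for k f W using that by (simp add: orientation_def)
  interpret cx: colored_om "E - {x}" "{v \<in> L. v x = Zero}" "I - {i}" P
    by (rule contraction_colored[OF ij(1) xs(1)])
  interpret cz: colored_om "E - {z}" "{v \<in> L. v z = Zero}" "I - {i}" P
    by (rule contraction_colored[OF ij(1) xs(2)])
  interpret cy: colored_om "E - {y}" "{v \<in> L. v y = Zero}" "I - {j}" P
    by (rule contraction_colored[OF ij(2) ys(1)])
  interpret cy0: colored_om "E - {y0}" "{v \<in> L. v y0 = Zero}" "I - {j}" P
    by (rule contraction_colored[OF ij(2) ys(2)])
  have L: "a \<in> L" "b \<in> L" "c \<in> L" "e \<in> L" using a b c e by (auto simp: V_def)
  note zeros = Vpq[OF a(1)] Vpq[OF b(1)] Vpq[OF c(1)] Vpq[OF e(1)]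
  have mixedV: "mixed I P v" if "V p q v" "p \<in> P i" "q \<in> P j" for p q v
    by (rule colorful_mixed[of v I "T p q"]) (use that T[OF that(2,3)] in \<open>auto simp: V_def\<close>)
  have ab: "a \<in> Y \<longleftrightarrow> b \<in> Y"
    by (rule cy.adjacent[OF link_inv[OF Y], of a b i x z])
      (use L zeros ij xs a(2) b(2) common[OF a(1) b(1)] in auto)
  have bc: "b \<in> Z \<longleftrightarrow> c \<in> Z"
    by (rule cz.adjacent[OF link_inv[OF Z], of b c j y y0])
      (use L zeros ij ys by0 c(2) common[OF b(1) c(1)] in auto)
  have ce: "c \<in> Y0 \<longleftrightarrow> e \<in> Y0"
    by (rule cy0.adjacent[OF link_inv[OF Y0], of c e i z x])
      (use L zeros ij xs cx e(2) common[OF c(1) e(1)] in auto)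
  have ae: "a \<in> X \<longleftrightarrow> e \<in> X"
    by (rule cx.adjacent[OF link_inv[OF X], of a e j y y0])
      (use L zeros ij ys ay0 \<open>e y = neg_sign (a y0)\<close> common[OF a(1) e(1)] in auto)
  have "b \<in> Z \<longleftrightarrow> b \<in> Y" "c \<in> Z \<longleftrightarrow> c \<in> Y0" "e \<in> X \<longleftrightarrow> e \<in> Y0"
    using agreeD[OF ag(1) L(2)] agreeD[OF ag(2) L(3)] agreeD[OF ag(3) L(4)] zeros
      mixedV[OF b(1) xs(2) ys(1)] mixedV[OF c(1) xs(2) ys(2)] mixedV[OF e(1) xs(1) ys(2)] by auto
  then have "a \<in> X \<longleftrightarrow> a \<in> Y" using ab bc ce ae by simp
  then show ?thesis
    using agree_from_witness[OF ij xs(1) ys(1) X Y L(1) mixedV[OF a(1) xs(1) ys(1)]] zeros by simp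
qed

text \<open>The elements of different colors form a complete multipartite graph whose edges carry the relative
signs of the orientations. A choice of signs along a spanning tree is consistent because
the cycles are generated by triangles with three colors and by quadrilaterals with two.\<close>
lemma consistent_link_orientations:
  assumes "2 \<le> card I"
    and links: "\<And>i x. i \<in> I \<Longrightarrow> x \<in> P i \<Longrightarrow> \<exists>X. link_orientation L I P i x X"
  shows "\<exists>A. (\<forall>i\<in>I. \<forall>x\<in>P i. link_orientation L I P i x (A x)) \<and>
    (\<forall>i\<in>I. \<forall>j\<in>I. \<forall>x\<in>P i. \<forall>y\<in>P j. i \<noteq> j \<longrightarrow> agree L I P x y (A x) (A y))"
proof -
  obtain i1 i2 where i12: "i1 \<in> I" "i2 \<in> I" "i1 \<noteq> i2"
    using assms(1) card_le_Suc0_iff_eq[OF finite_colors] by force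
  \<comment> \<open>The spanning tree: \<open>z\<close> is joined to all elements outside its class, \<open>y0\<close> to the class of \<open>z\<close>.\<close>
  obtain z y0 where z: "z \<in> P i1" and y0: "y0 \<in> P i2" using class_nonempty i12 by blast
  obtain Z where Z: "link_orientation L I P i1 z Z" using links[OF i12(1) z] by blast
  have "\<forall>y\<in>colored - P i1. \<exists>Y. \<forall>j\<in>I. y \<in> P j \<longrightarrow> link_orientation L I P j y Y \<and> agree L I P z y Z Y"
  proof
    fix y assume "y \<in> colored - P i1"
    then obtain j where j: "j \<in> I" "y \<in> P j" "i1 \<noteq> j" by auto
    obtain Y where Y: "link_orientation L I P j y Y" "agree L I P z y Z Y"
      using links[OF j(1,2)] matching_link_orientation[OF i12(1) j(1,3) z j(2) Z] by blast
    show "\<exists>Y. \<forall>j\<in>I. y \<in> P j \<longrightarrow> link_orientation L I P j y Y \<and> agree L I P z y Z Y"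
    proof (intro exI[of _ Y] ballI impI)
      fix k assume "k \<in> I" "y \<in> P k"
      then have "k = j" using color_unique[OF _ j(1) _ j(2)] by blast
      then show "link_orientation L I P k y Y \<and> agree L I P z y Z Y" using Y by simp
    qed
  qed
  from bchoice[OF this] obtain A1 where "\<forall>y\<in>colored - P i1. \<forall>j\<in>I. y \<in> P j \<longrightarrow>
      link_orientation L I P j y (A1 y) \<and> agree L I P z y Z (A1 y)" ..
  note A1 = this[THEN bspec, THEN bspec, THEN mp]
  have other: "y \<in> colored - P i1" if "j \<in> I" "j \<noteq> i1" "y \<in> P j" for j y
    using that color_unique[OF that(1) i12(1) that(3)] by blast
  have y0A: "link_orientation L I P i2 y0 (A1 y0)" "agree L I P z y0 Z (A1 y0)"
    using A1[OF other[of i2 y0] i12(2) y0] i12 y0 by auto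
  have "\<forall>x\<in>P i1. \<exists>X. link_orientation L I P i1 x X \<and> agree L I P y0 x (A1 y0) X"
  proof
    fix x assume x: "x \<in> P i1"
    then obtain X where "link_orientation L I P i1 x X" using links[OF i12(1)] by blast
    then show "\<exists>X. link_orientation L I P i1 x X \<and> agree L I P y0 x (A1 y0) X"
      by (rule matching_link_orientation[OF i12(2,1) i12(3)[symmetric] y0 x y0A(1)])
  qed
  from bchoice[OF this] obtain A2 where "\<forall>x\<in>P i1.
      link_orientation L I P i1 x (A2 x) \<and> agree L I P y0 x (A1 y0) (A2 x)" ..
  note A2 = this[THEN bspec]
  define A where "A x = (if x = z then Z else if x \<in> P i1 then A2 x else A1 x)" for x
  have Az: "A z = Z" by (simp add: A_def)
  have A_other: "A y = A1 y" if "j \<in> I" "j \<noteq> i1" "y \<in> P j" for j y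
    using other[OF that] z by (auto simp: A_def)
  have base: "link_orientation L I P j y (A y)" "agree L I P z y (A z) (A y)"
    if "j \<in> I" "j \<noteq> i1" "y \<in> P j" for j y
    using A1[OF other[OF that] that(1,3)] A_other[OF that] Az by auto
  have first: "link_orientation L I P i1 x (A x)" "agree L I P x y0 (A x) (A y0)" if "x \<in> P i1" for x
    using that A2[OF that] Z y0A A_other[OF i12(2) _ y0] i12(3) agree_sym[of L I P y0 x]
    by (auto simp: A_def)
  have ori: "link_orientation L I P i x (A x)" if "i \<in> I" "x \<in> P i" for i x
    using base(1)[OF that(1) _ that(2)] first(1)[of x] that by (cases "i = i1") auto
  have not_first: "agree L I P y y' (A y) (A y')"
    if "j \<in> I" "j' \<in> I" "j \<noteq> j'" "j \<noteq> i1" "j' \<noteq> i1" "y \<in> P j" "y' \<in> P j'" for j j' y y'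
    using agree_trans[of j i1 j' y z y' "A y" "A y'" "A z"] that i12(1) z
      base[OF that(1,4,6)] base[OF that(2,5,7)] agree_sym[of L I P y z] by auto
  have with_first: "agree L I P x y (A x) (A y)" if x: "x \<in> P i1" and y: "j \<in> I" "j \<noteq> i1" "y \<in> P j" for x y j
  proof (cases "j = i2")
    case False
    show ?thesis
      by (rule agree_trans[OF i12(1,2) y(1) i12(3) _ _ x y0 y(3) first(1)[OF x] base(1)[OF y] first(2)[OF x]])
        (use not_first[OF i12(2) y(1) _ _ y(2) y0 y(3)] False i12(3) y(2) in auto)
  next
    case True
    consider "x = z" | "y = y0" | "x \<noteq> z" "y \<noteq> y0" by blast
    then show ?thesis
    proof cases
      case 1
      then show ?thesis using base(2)[OF y] by simp
    next
      case 2
      then show ?thesis using first(2)[OF x] by simp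
    next
      case 3
      show ?thesis
        by (rule agree_square[OF i12 x z 3(1) _ y0 3(2) first(1)[OF x] first(1)[OF z]])
          (use True y base ori[OF i12(2) y0] first(2) x z in auto)
    qed
  qed
  have "agree L I P x y (A x) (A y)" if "i \<in> I" "j \<in> I" "i \<noteq> j" "x \<in> P i" "y \<in> P j" for i j x y
    using with_first[of x j y] with_first[of y i x] not_first[of i j x y] that agree_sym[of L I P x y]
    by metis
  with ori show ?thesis by blast
qed

text \<open>If \<open>u\<close> has a zero \<open>y\<close> of another color, the orientations at \<open>x\<close> and \<open>x'\<close> both agree with the one at
\<open>y\<close>. Otherwise, with at least three colors, a face of \<open>u\<close> in the contraction by \<open>x\<close> and \<open>x'\<close> has such a
zero. With two colors this contraction has rank one and no proper faces. There \<open>u\<close> is joined to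
\<open>a\<close> vanishing at \<open>x\<close>, \<open>y\<close>, and to \<open>b\<close> vanishing at \<open>x'\<close>, \<open>y\<close>, and well-separation forces the
signs for which \<open>a\<close> and \<open>b\<close> are joined by exchanging \<open>x\<close> for \<open>x'\<close>.\<close>
lemma agree_same_color:
  assumes ori: "\<And>i x. i \<in> I \<Longrightarrow> x \<in> P i \<Longrightarrow> link_orientation L I P i x (A x)"
    and cons: "\<And>i j x y. i \<in> I \<Longrightarrow> j \<in> I \<Longrightarrow> i \<noteq> j \<Longrightarrow> x \<in> P i \<Longrightarrow> y \<in> P j \<Longrightarrow>
      agree L I P x y (A x) (A y)"
    and sep: "separated L I P" and card2: "2 \<le> card I"
    and i: "i \<in> I" and xx: "x \<in> P i" "x' \<in> P i" "x \<noteq> x'"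
  shows "agree L I P x x' (A x) (A x')"
  unfolding agree_def
proof (intro ballI impI)
  fix u assume u: "u \<in> L" "mixed I P u" "u x = Zero" "u x' = Zero"
  have link_inv: "invariant {v \<in> L. v f = Zero} (I - {k}) P (A f)" if "k \<in> I" "f \<in> P k" for k f
    using ori[OF that] by (simp add: orientation_def)
  have cardI: "card (I - {i}) + 1 = card I"
    using finite_colors i card2 by simp
  let ?F = "\<Union> (P ` (I - {i}))"
  have via: "c \<in> A x \<longleftrightarrow> c \<in> A x'"
    if "c \<in> L" "mixed I P c" "c x = Zero" "c x' = Zero" "y \<in> ?F" "c y = Zero" for c y
  proof -
    obtain j where j: "j \<in> I" "i \<noteq> j" "y \<in> P j" using \<open>y \<in> ?F\<close> by blast
    show ?thesis
      using agreeD[OF cons[OF i j(1,2) xx(1) j(3)], of c] agreeD[OF cons[OF i j(1,2) xx(2) j(3)], of c] that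
      by simp
  qed
  show "u \<in> A x \<longleftrightarrow> u \<in> A x'"
  proof (cases "\<exists>y\<in>?F. u y = Zero")
    case True
    then show ?thesis using via[OF u] by blast
  next
    case no_zero: False
    show ?thesis
    proof (cases "3 \<le> card I")
      case True
      interpret cx: colored_om "E - {x}" "{v \<in> L. v x = Zero}" "I - {i}" P
        by (rule contraction_colored[OF i xx(1)])
      interpret cxx: uniform_om "E - {x} - {x'}" "{v \<in> {v \<in> L. v x = Zero}. v x' = Zero}" "card (I - {i})"
        using cx.contraction[of x'] xx class_subset[OF i] by auto
      have "?F \<subseteq> E - {x} - {x'}"
        using class_subset color_unique[OF i] xx by blast
      moreover have "card (I - {i}) \<le> card ?F"
      proof -
        obtain t where t: "\<And>k. k \<in> I - {i} \<Longrightarrow> t k \<in> P k"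
          using cx.transversal_exists by blast
        show ?thesis
          using cx.transversal_card[of t] t card_mono[OF cx.finite_colored] by metis
      qed
      moreover have "2 \<le> card (I - {i})" using True cardI by simp
      ultimately obtain c y where c: "c \<in> L" "c x = Zero" "c x' = Zero" "c \<noteq> null" "y \<in> ?F" "c y = Zero"
        "conformal_on ?F c u" and f: "\<exists>f\<in>?F. c f \<noteq> Zero"
      proof (rule_tac cxx.proper_face_exists[of u ?F])
        fix c y assume c: "c \<in> {v \<in> {v \<in> L. v x = Zero}. v x' = Zero}" "c \<noteq> null"
          "y \<in> ?F" "c y = Zero" "conformal_on ?F c u"
        have "\<exists>f\<in>?F. c f \<noteq> Zero"
          using cxx.null_if_many_zeros[of c ?F] c \<open>?F \<subseteq> E - {x} - {x'}\<close> \<open>card (I - {i}) \<le> card ?F\<close> by blast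
        with c that show thesis by blast
      qed (use u no_zero in auto)
      obtain f where f: "f \<in> ?F" "c f \<noteq> Zero" using f by blast
      have mixed_c: "mixed (I - {i}) P c"
        by (rule mixed_face[of "I - {i}" P u])
          (use u xx i c mixed_contraction[of i I x P u] in \<open>auto simp: conformal_on_def\<close>)
      then have mc: "mixed I P c" using mixed_contraction[of i I x P c] i xx c by simp
      have reach: "c \<in> A w \<longleftrightarrow> u \<in> A w" if w: "w \<in> P i" "u w = Zero" "c w = Zero" for w
      proof -
        interpret cw: colored_om "E - {w}" "{v \<in> L. v w = Zero}" "I - {i}" P
          by (rule contraction_colored[OF i w(1)])
        have mu: "mixed (I - {i}) P u" using mixed_contraction[of i I x P u] i xx u by simp
        show ?thesis
          by (rule cw.conformal_connected[OF link_inv[OF i w(1)], of u c u])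
            (use u c f mu w in \<open>auto simp: conformal_on_def mixed_def\<close>)
      qed
      show ?thesis
        using reach[OF xx(1) u(3) c(2)] reach[OF xx(2) u(4) c(3)] via[OF c(1) mc c(2,3,5,6)] by simp
    next
      case False
      then have "card (I - {i}) = 1" using card2 cardI by simp
      then obtain j where "I - {i} = {j}" using card_1_singletonE by blast
      then have I: "I = {i, j}" "i \<noteq> j" "j \<in> I" "card I = 2" using i by (blast, blast, blast, use card2 False in simp)
      obtain y y' where y: "y \<in> P j" "y' \<in> P j" "u y = Plus" "u y' = Minus"
        using mixed_both_signs[OF u(2) I(3)] no_zero \<open>I - {i} = {j}\<close> by blast
      then have yy: "y' \<noteq> y" by auto
      have near: "\<exists>a\<in>L. a w = Zero \<and> a y = Zero \<and> a y' = Minus \<and> (a \<in> A w \<longleftrightarrow> u \<in> A w) \<and>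
          (\<forall>f\<in>P i. f \<noteq> w \<longrightarrow> a f \<noteq> Zero)"
        if w: "w \<in> P i" "u w = Zero" for w
      proof -
        define t where "t k = (if k = i then w else y)" for k
        have t: "\<And>k. k \<in> I \<Longrightarrow> t k \<in> P k" using I w y by (auto simp: t_def)
        have "y' \<notin> t ` I" using not_in_transversal[OF t I(3) y(2)] yy I(2) by (simp add: t_def)
        moreover have "y' \<in> E" using y(2) class_subset[OF I(3)] by blast
        ultimately obtain a where a: "a \<in> L" "\<And>k. k \<in> I \<Longrightarrow> a (t k) = Zero" "a y' = Minus"
          using colorful_with_sign[OF t, of y' Minus] by blast
        have az: "a w = Zero" "a y = Zero" using a(2)[OF i] a(2)[OF I(3)] I(2) by (simp_all add: t_def)
        have an: "a \<noteq> null" using a(3) by auto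
        have nz: "a f \<noteq> Zero" if "f \<in> P i" "f \<noteq> w" for f
          using colorful_nonzero[OF t a(1) an a(2) i that(1)] that(2) by (simp add: t_def)
        interpret cw: colored_om "E - {w}" "{v \<in> L. v w = Zero}" "I - {i}" P
          by (rule contraction_colored[OF i w(1)])
        have ma: "mixed I P a" by (rule colorful_mixed[of a I t]) (use an t a in auto)
        have jm: "jointly Minus a u y'" "jointly Plus a u y"
          using a(3) y az by (auto simp: jointly_def)
        have "a \<in> A w \<longleftrightarrow> u \<in> A w"
        proof (rule cw.mixed_path[OF link_inv[OF i w(1)] _ _ _ _ _ jm(1)])
          show "mixed (I - {i}) P a" "mixed (I - {i}) P u"
            using mixed_contraction[of i I w P] i w az ma u by auto
          fix k assume "k \<in> I - {i}"
          then have "k = j" using I by auto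
          then show "(\<exists>x\<in>P k. a x = Zero \<and> u x = Zero) \<or>
              (\<exists>s p q. s \<noteq> Zero \<and> p \<in> P k \<and> q \<in> P k \<and> jointly s a u p \<and> jointly (neg_sign s) a u q)"
            using jm y by (intro disjI2 exI[of _ Plus] exI[of _ y] exI[of _ y']) simp
        qed (use a az u w in auto)
        with a az nz show ?thesis by blast
      qed
      obtain a where a: "a \<in> L" "a x = Zero" "a y = Zero" "a y' = Minus" "a \<in> A x \<longleftrightarrow> u \<in> A x" "a x' \<noteq> Zero"
        using near[OF xx(1) u(3)] xx by metis
      obtain b where b: "b \<in> L" "b x' = Zero" "b y = Zero" "b y' = Minus" "b \<in> A x' \<longleftrightarrow> u \<in> A x'" "b x \<noteq> Zero"
        using near[OF xx(2) u(4)] xx by metis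
      have "b x = neg_sign (a x')"
      proof (rule ccontr)
        assume "b x \<noteq> neg_sign (a x')"
        then have bx: "b x = a x'" using nonzero_sign_cases[OF a(6) b(6)] by blast
        \<comment> \<open>Eliminating \<open>x'\<close> and \<open>x\<close> from this pattern leaves zeros at both and equal signs at \<open>y\<close> and \<open>y'\<close>, unlike \<open>u\<close>.\<close>
        have "\<forall>k\<in>I. (if k = i then a x' else Plus) \<noteq> Zero" using a(6) by simp
        then obtain X where X: "X \<in> L" "\<And>k e. k \<in> I \<Longrightarrow> e \<in> P k \<Longrightarrow> X e = (if k = i then a x' else Plus)"
          using sep[unfolded separated_def, THEN spec, of "\<lambda>k. if k = i then a x' else Plus"] by blast
        have Xv: "X x = a x'" "X x' = a x'" "X y = Plus" "X y' = Plus"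
          using X(2)[OF i xx(1)] X(2)[OF i xx(2)] X(2)[OF I(3) y(1)] X(2)[OF I(3) y(2)] I(2) by simp_all
        obtain z where z: "z \<in> L" "z x' = Zero"
          "\<And>f. f \<notin> separation_set X (opp a) \<Longrightarrow> z f = compose_sv X (opp a) f"
          using eliminate[OF X(1) neg_covector[OF a(1)], of x'] Xv a(6) by auto
        have zv: "z x = a x'" "z y = Plus" "z y' = Plus"
          using z(3)[of x] z(3)[of y] z(3)[of y'] Xv a by (auto simp: separation_set_def compose_sv_def)
        obtain z' where z': "z' \<in> L" "z' x = Zero"
          "\<And>f. f \<notin> separation_set z (opp b) \<Longrightarrow> z' f = compose_sv z (opp b) f"
          using eliminate[OF z(1) neg_covector[OF b(1)], of x] zv bx a(6) by auto
        have zv': "z' x' = Zero" "z' y = Plus" "z' y' = Plus"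
          using z'(3)[of x'] z'(3)[of y] z'(3)[of y'] zv z(2) b by (auto simp: separation_set_def compose_sv_def)
        have "z' = u"
          by (rule cocircuit_unique[OF z'(1) u(1), of "{x, x'}" y])
            (use xx class_subset[OF i] I(4) z'(2) zv' u y in auto)
        then show False using zv' y by simp
      qed
      interpret cy: colored_om "E - {y}" "{v \<in> L. v y = Zero}" "I - {j}" P
        by (rule contraction_colored[OF I(3) y(1)])
      have ab: "a \<in> A y \<longleftrightarrow> b \<in> A y"
        by (rule cy.adjacent[OF link_inv[OF I(3) y(1)], of a b i x x'])
          (use a b i I xx \<open>b x = neg_sign (a x')\<close> in auto)
      have nn: "a \<noteq> null" "b \<noteq> null" using a(4) b(4) by auto
      have ma: "mixed I P a" "mixed I P b"
        by (rule mixedI[OF nn(1)], use a(2,3) I(1) xx(1) y(1) in blast)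
          (rule mixedI[OF nn(2)], use b(2,3) I(1) xx(2) y(1) in blast)
      show ?thesis
        using agreeD[OF cons[OF i I(3,2) xx(1) y(1)] a(1) ma(1) a(2,3)]
          agreeD[OF cons[OF i I(3,2) xx(2) y(1)] b(1) ma(2) b(2,3)] ab a(5) b(5) by simp
    qed
  qed
qed

text \<open>The side of a mixed covector is read off at any of its faces \<open>c\<close> and any colored zero of \<open>c\<close>.
It does not depend on the zero because the orientations agree, nor on \<open>c\<close> because the faces are
connected. Faces of a smaller covector are faces of a larger one, which gives invariance.\<close>
lemma orientation_from_links:
  assumes card2: "2 \<le> card I" and big: "Suc (card I) \<le> card colored" and sep: "separated L I P"
    and links: "\<And>i x. i \<in> I \<Longrightarrow> x \<in> P i \<Longrightarrow> \<exists>X. link_orientation L I P i x X"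
  shows "\<exists>A. orientation L I P A"
proof -
  from consistent_link_orientations[OF card2 links] obtain A
    where A: "\<forall>i\<in>I. \<forall>x\<in>P i. link_orientation L I P i x (A x)"
      "\<forall>i\<in>I. \<forall>j\<in>I. \<forall>x\<in>P i. \<forall>y\<in>P j. i \<noteq> j \<longrightarrow> agree L I P x y (A x) (A y)" by blast
  have ori: "link_orientation L I P i x (A x)" if "i \<in> I" "x \<in> P i" for i x
    using A(1) that by blast
  have cons: "agree L I P x y (A x) (A y)"
    if "i \<in> I" "j \<in> I" "i \<noteq> j" "x \<in> P i" "y \<in> P j" for i j x y
    using A(2) that by blast
  have indep: "u \<in> A x \<longleftrightarrow> u \<in> A y"
    if u: "u \<in> L" "mixed I P u" "x \<in> colored" "y \<in> colored" "u x = Zero" "u y = Zero" for u x y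
  proof -
    obtain i j where ij: "i \<in> I" "j \<in> I" "x \<in> P i" "y \<in> P j" using u by blast
    have "agree L I P x y (A x) (A y)" if "x \<noteq> y"
    proof (cases "i = j")
      case True
      with ij(4) have "y \<in> P i" by simp
      from agree_same_color[of A, OF _ _ sep card2 ij(1,3) this that] show ?thesis using ori cons by blast
    next
      case False
      then show ?thesis using cons[OF ij(1,2) _ ij(3,4)] by blast
    qed
    then show ?thesis using agreeD[of L I P x y "A x" "A y" u] u by blast
  qed
  have I: "I \<noteq> {}" using card2 by auto
  have face_mixed: "mixed I P c" if "c \<in> faces colored u" "mixed I P u" for c u
    by (rule mixed_face[OF that(2)]) (use that(1) in \<open>auto simp: faces_def conformal_on_def\<close>)
  have face_sign: "c e = Zero \<or> c e = u e" if "c \<in> faces colored u" "e \<in> colored" for c u e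
    using that unfolding faces_def conformal_on_def by blast
  have sharing: "c \<in> A x \<longleftrightarrow> c' \<in> A x"
    if u: "u \<in> L" "mixed I P u" and c: "c \<in> faces colored u" "c' \<in> faces colored u"
      and x: "x \<in> colored" "c x = Zero" "c' x = Zero" for u c c' x
  proof -
    obtain i where i: "i \<in> I" "x \<in> P i" using x by blast
    interpret cx: colored_om "E - {x}" "{v \<in> L. v x = Zero}" "I - {i}" P
      by (rule contraction_colored[OF i])
    have inv: "invariant {v \<in> L. v x = Zero} (I - {i}) P (A x)"
      using ori[OF i] by (simp add: orientation_def)
    obtain f where f: "f \<in> colored" "c f \<noteq> Zero"
      using face_nonzero[OF c(1) colored_subset big] by blast
    have "mixed (I - {i}) P u"
      using u(2) by (simp add: mixed_def)
    moreover have "conformal_on (insert f (\<Union> (P ` (I - {i})))) d u" if "d \<in> faces colored u" for d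
      using face_sign[OF that] f(1) unfolding conformal_on_def by blast
    ultimately show ?thesis
      by (intro cx.conformal_connected[of _ u c c' f] inv) (use c x f in \<open>auto simp: faces_def\<close>)
  qed
  \<comment> \<open>The side of a covector that has a colored zero.\<close>
  define good where "good c \<longleftrightarrow> (\<exists>x\<in>colored. c x = Zero \<and> c \<in> A x)" for c
  have good: "good c \<longleftrightarrow> c \<in> A x" if "c \<in> L" "mixed I P c" "x \<in> colored" "c x = Zero" for c x
  proof
    assume "good c"
    then obtain z where z: "z \<in> colored" "c z = Zero" "c \<in> A z" unfolding good_def by blast
    from indep[OF that(1,2) z(1) that(3) z(2) that(4)] z(3) show "c \<in> A x" by simp
  next
    assume "c \<in> A x"
    then show "good c" unfolding good_def using that(3,4) by blast
  qed
  have share_good: "good c \<longleftrightarrow> good c'"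
    if u: "u \<in> L" "mixed I P u" and c: "c \<in> faces colored u" "c' \<in> faces colored u"
      and x: "x \<in> colored" "c x = Zero" "c' x = Zero" for u c c' x
  proof -
    have "c \<in> L" "c' \<in> L" using c by (simp_all add: faces_def)
    from good[OF this(1) face_mixed[OF c(1) u(2)] x(1,2)] good[OF this(2) face_mixed[OF c(2) u(2)] x(1,3)]
    show ?thesis using sharing[OF u c x] by simp
  qed
  have const: "good c'" if u: "u \<in> L" "mixed I P u" and c: "c \<in> faces colored u" "c' \<in> faces colored u"
      and g: "good c" for u c c'
  proof (cases "\<exists>x\<in>colored. u x = Zero")
    case True
    then obtain x where x: "x \<in> colored" "u x = Zero" by blast
    then have "c x = Zero" "c' x = Zero" using face_sign[OF c(1) x(1)] face_sign[OF c(2) x(1)] by auto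
    then show ?thesis using share_good[OF u c x(1)] g by blast
  next
    case False
    show ?thesis
    proof (rule faces_connected[OF _ colored_subset big _ _ c])
      show "good c'" if "c \<in> faces colored u" "c' \<in> faces colored u" "x \<in> colored" "c x = Zero" "c' x = Zero"
        "good c" for c c' x using share_good[OF u that(1-5)] that(6) by blast
    qed (use card2 False g in auto)
  qed
  have some_face: "\<exists>c. c \<in> faces colored u" if u: "u \<in> L" "mixed I P u" for u
  proof -
    obtain c i x where "c \<in> L" "mixed I P c" "i \<in> I" "x \<in> P i" "c x = Zero" "conformal_on colored c u"
      by (rule connected_to_face[OF big I u], rule that)
    then show ?thesis by (auto simp: faces_def mixed_def)
  qed
  define U where "U = {u. \<exists>c\<in>faces colored u. good c}"
  have U: "u \<in> U \<longleftrightarrow> good c" if "u \<in> L" "mixed I P u" "c \<in> faces colored u" for u c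
    using const[OF that(1,2) _ that(3)] that(3) by (auto simp: U_def)
  have "orientation L I P U"
    unfolding orientation_def invariant_def
  proof (intro conjI ballI impI)
    fix u w assume *: "u \<in> L" "w \<in> L" "mixed I P u" "mixed I P w" "conformal_on UNIV u w"
    obtain c where c: "c \<in> faces colored u" using some_face[OF *(1,3)] by blast
    have "conformal_on colored c w"
      unfolding conformal_on_def
    proof
      fix e assume "e \<in> colored"
      then have "c e = Zero \<or> c e = u e" by (rule face_sign[OF c])
      then show "c e = Zero \<or> c e = w e" using *(5) by (auto simp: conformal_on_def)
    qed
    then have "c \<in> faces colored w" using c by (auto simp: faces_def)
    then show "u \<in> U \<longleftrightarrow> w \<in> U" using U[OF *(1,3) c] U[OF *(2,4)] by blast
  next
    fix u assume u: "u \<in> L" "mixed I P u"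
    obtain c where c: "c \<in> faces colored u" using some_face[OF u] by blast
    then obtain i x where x: "i \<in> I" "x \<in> P i" "c x = Zero" by (auto simp: faces_def)
    have cL: "c \<in> L" "mixed I P c" using c face_mixed[OF c u(2)] by (auto simp: faces_def)
    have "opp c \<in> faces colored (opp u)"
      using c neg_covector[OF cL(1)] by (auto simp: faces_def conformal_on_def)
    then have "opp u \<in> U \<longleftrightarrow> good (opp c)" using U[OF neg_covector[OF u(1)]] u(2) by simp
    moreover have "u \<in> U \<longleftrightarrow> good c" using U[OF u c] .
    moreover have "good (opp c) \<longleftrightarrow> opp c \<in> A x" "good c \<longleftrightarrow> c \<in> A x"
      using good[of "opp c" x] good[of c x] neg_covector[OF cL(1)] cL x by auto
    moreover have "opp c \<in> A x \<longleftrightarrow> c \<notin> A x"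
      using ori[OF x(1,2)] cL x mixed_contraction[of i I x P c] by (simp add: orientation_def)
    ultimately show "opp u \<in> U \<longleftrightarrow> u \<notin> U" by simp
  qed
  then show ?thesis by blast
qed

end

theorem orientation_exists:
  assumes "colored_om E L I P" "separated L I P"
  shows "\<exists>A. orientation L I P A"
  using assms
proof (induction "card I" arbitrary: E L I rule: less_induct)
  case less
  interpret colored_om E L I P by fact
  show ?case
  proof (cases "card colored \<le> card I")
    case True
    then show ?thesis by (rule orientation_if_singletons)
  next
    case False
    then have big: "Suc (card I) \<le> card colored" by simp
    then have "I \<noteq> {}" by auto
    then have "card I \<noteq> 0" using finite_colors by simp
    show ?thesis
    proof (cases "card I = 1")
      case True
      then obtain i where "I = {i}" by (rule card_1_singletonE)
      then show ?thesis using orientation_one_color[of i] big less.prems(2) by simp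
    next
      case False
      with \<open>card I \<noteq> 0\<close> have "2 \<le> card I" by simp
      then show ?thesis
      proof (rule orientation_from_links[OF _ big less.prems(2)])
        fix i x assume i: "i \<in> I" "x \<in> P i"
        have "card (I - {i}) < card I" by (rule card_Diff1_less[OF finite_colors i(1)])
        from less.hyps[OF this contraction_colored[OF i] separated_contraction[OF less.prems(2) i]]
        show "\<exists>X. link_orientation L I P i x X" .
      qed
    qed
  qed
qed

section \<open>Counting colorful covectors\<close>

text \<open>With \<open>Minus < Zero < Plus\<close>, the condition excludes elements with \<open>v e > w e\<close>, so the minuses of \<open>w\<close>
are minuses of \<open>v\<close> and the pluses of \<open>v\<close> are pluses of \<open>w\<close>. Equal counts turn both inclusions into equalities.\<close>
lemma equal_if_never_greater:
  assumes fin: "finite S" and zeros: "card {e \<in> S. v e = Zero} = card {e \<in> S. w e = Zero}"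
    and minus: "card {e \<in> S. v e = Minus} = card {e \<in> S. w e = Minus}"
    and no: "\<not> (\<exists>p\<in>S. jointly Plus v (opp w) p)"
  shows "\<forall>e\<in>S. v e = w e"
proof -
  have le: "(w e = Minus \<longrightarrow> v e = Minus) \<and> (v e = Plus \<longrightarrow> w e = Plus)" if "e \<in> S" for e
  proof -
    have "\<not> jointly Plus v (opp w) e" using no that by blast
    then show ?thesis by (cases "v e"; cases "w e") (simp_all add: jointly_def)
  qed
  have "{e \<in> S. w e = Minus} \<subseteq> {e \<in> S. v e = Minus}" using le by blast
  then have m: "{e \<in> S. w e = Minus} = {e \<in> S. v e = Minus}"
    by (rule card_subset_eq[rotated]) (use fin minus in simp_all)
  have part: "card S = card {e \<in> S. u e = Zero} + card {e \<in> S. u e = Minus} + card {e \<in> S. u e = Plus}"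
    for u :: "'a \<Rightarrow> sign"
  proof -
    have "S = ({e \<in> S. u e = Zero} \<union> {e \<in> S. u e = Minus}) \<union> {e \<in> S. u e = Plus}"
      using sign.exhaust by blast
    then have "card S = card (({e \<in> S. u e = Zero} \<union> {e \<in> S. u e = Minus}) \<union> {e \<in> S. u e = Plus})"
      by simp
    also have "\<dots> = card ({e \<in> S. u e = Zero} \<union> {e \<in> S. u e = Minus}) + card {e \<in> S. u e = Plus}"
      by (rule card_Un_disjoint) (use fin in auto)
    also have "card ({e \<in> S. u e = Zero} \<union> {e \<in> S. u e = Minus}) =
        card {e \<in> S. u e = Zero} + card {e \<in> S. u e = Minus}"
      by (rule card_Un_disjoint) (use fin in auto)
    finally show ?thesis .
  qed
  have "card {e \<in> S. v e = Plus} = card {e \<in> S. w e = Plus}"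
    using part[of v] part[of w] zeros minus by simp
  moreover have "{e \<in> S. v e = Plus} \<subseteq> {e \<in> S. w e = Plus}" using le by blast
  ultimately have p: "{e \<in> S. v e = Plus} = {e \<in> S. w e = Plus}"
    by (intro card_subset_eq) (use fin in simp_all)
  show ?thesis
  proof
    fix e assume e: "e \<in> S"
    have "v e = Minus \<longleftrightarrow> w e = Minus" "v e = Plus \<longleftrightarrow> w e = Plus" using m p e by blast+
    then show "v e = w e" by (cases "v e"; cases "w e") auto
  qed
qed

context colored_om
begin

lemma colorful_zeros:
  assumes "\<And>i. i \<in> I \<Longrightarrow> t i \<in> P i" "v \<in> L" "mixed I P v" "\<And>i. i \<in> I \<Longrightarrow> v (t i) = Zero" "i \<in> I"
  shows "{e \<in> P i. v e = Zero} = {t i}"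
proof -
  have "v \<noteq> null" using assms(3) by (simp add: mixed_def)
  from colorful_nonzero[OF assms(1,2) this assms(4,5)] show ?thesis using assms(1,4,5) by blast
qed

lemma colorful_determined_by_counts:
  assumes A: "orientation L I P A" and all: "colored = E"
    and v: "v \<in> L" "v \<in> A" "mixed I P v" and w: "w \<in> L" "w \<in> A" "mixed I P w"
    and zeros: "\<And>i. i \<in> I \<Longrightarrow> card {e \<in> P i. v e = Zero} = 1" "\<And>i. i \<in> I \<Longrightarrow> card {e \<in> P i. w e = Zero} = 1"
    and minus: "\<And>i. i \<in> I \<Longrightarrow> card {e \<in> P i. v e = Minus} = card {e \<in> P i. w e = Minus}"
  shows "v = w"
proof (rule ccontr)
  assume "v \<noteq> w"
  then obtain f where f: "v f \<noteq> w f" by auto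
  have "\<exists>s. s \<noteq> Zero \<and> jointly s v (opp w) f"
    using f by (cases "v f"; cases "w f") (auto simp: jointly_def)
  then obtain s where s: "s \<noteq> Zero" "jointly s v (opp w) f" by blast
  have inv: "invariant L I P A" using A by (simp add: orientation_def)
  have "v \<in> A \<longleftrightarrow> opp w \<in> A"
  proof (rule mixed_path[OF inv v(1) neg_covector[OF w(1)] v(3) _ s])
    fix i assume i: "i \<in> I"
    have fin: "finite (P i)" using finite_subset[OF class_subset[OF i] finite_ground] .
    have z: "card {e \<in> P i. v e = Zero} = card {e \<in> P i. w e = Zero}" using zeros[OF i] by simp
    show "(\<exists>x\<in>P i. v x = Zero \<and> opp w x = Zero) \<or>
      (\<exists>s p q. s \<noteq> Zero \<and> p \<in> P i \<and> q \<in> P i \<and> jointly s v (opp w) p \<and> jointly (neg_sign s) v (opp w) q)"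
    proof (cases "\<forall>e\<in>P i. v e = w e")
      case True
      obtain x where "{e \<in> P i. v e = Zero} = {x}" using zeros(1)[OF i] by (rule card_1_singletonE)
      then have "x \<in> P i" "v x = Zero" by blast+
      then show ?thesis using True by auto
    next
      case False
      then have "\<exists>p\<in>P i. jointly Plus v (opp w) p"
        using equal_if_never_greater[OF fin z minus[OF i]] by blast
      moreover have "\<exists>p\<in>P i. jointly Plus w (opp v) p"
        using equal_if_never_greater[OF fin z[symmetric] minus[OF i, symmetric]] False by metis
      moreover have "jointly Plus w (opp v) q \<longleftrightarrow> jointly Minus v (opp w) q" for q
        by (auto simp: jointly_def)
      ultimately show ?thesis by (metis neg_sign.simps(3) sign.distinct(5))
    qed
  qed (use w in simp)
  moreover have "opp w \<in> A \<longleftrightarrow> w \<notin> A" using A w by (simp add: orientation_def)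
  ultimately show False using v w by simp
qed

text \<open>The vector of counts, shifted by one, is an injective function of the zero set with values in a set of the
same finite size, hence surjective.\<close>
theorem colorful_covector_with_counts:
  assumes sep: "separated L I P" and all: "colored = E"
    and \<alpha>: "\<And>i. i \<in> I \<Longrightarrow> \<alpha> i \<in> {1..card (P i)}"
  shows "\<exists>v\<in>L. \<forall>i\<in>I. card {e \<in> P i. v e = Zero} = 1 \<and> card {e \<in> P i. v e = Minus} = \<alpha> i - 1"
proof -
  obtain A where A: "orientation L I P A" using orientation_exists[OF colored_om_axioms sep] by blast
  have finP: "finite (P i)" if "i \<in> I" for i using finite_subset[OF class_subset[OF that] finite_ground] .
  have "\<exists>v. v \<in> L \<and> v \<in> A \<and> mixed I P v \<and> (\<forall>i\<in>I. v (t i) = Zero)" if t: "t \<in> PiE I P" for t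
  proof -
    have "\<And>i. i \<in> I \<Longrightarrow> t i \<in> P i" using t by auto
    then obtain v where v: "v \<in> L" "\<And>i. i \<in> I \<Longrightarrow> v (t i) = Zero" "mixed I P v"
      using colorful_exists[of t] by blast
    then have "opp v \<in> A \<longleftrightarrow> v \<notin> A" using A by (simp add: orientation_def)
    then show ?thesis using v neg_covector[OF v(1)] by (cases "v \<in> A") auto
  qed
  then have "\<forall>t\<in>PiE I P. \<exists>v. v \<in> L \<and> v \<in> A \<and> mixed I P v \<and> (\<forall>i\<in>I. v (t i) = Zero)" by blast
  from bchoice[OF this] obtain V where V: "\<forall>t\<in>PiE I P. V t \<in> L \<and> V t \<in> A \<and> mixed I P (V t) \<and>
    (\<forall>i\<in>I. V t (t i) = Zero)" ..
  have zeros: "{e \<in> P i. V t e = Zero} = {t i}" if "t \<in> PiE I P" "i \<in> I" for t i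
    by (rule colorful_zeros) (use V that in auto)
  define N where "N t = (\<lambda>i\<in>I. Suc (card {e \<in> P i. V t e = Minus}))" for t
  have "N ` PiE I P \<subseteq> PiE I (\<lambda>i. {1..card (P i)})"
  proof
    fix n assume "n \<in> N ` PiE I P"
    then obtain t where t: "t \<in> PiE I P" "n = N t" by blast
    have "N t i \<in> {1..card (P i)}" if i: "i \<in> I" for i
    proof -
      have "t i \<in> P i" "V t (t i) = Zero" using V t i by auto
      then have "t i \<in> P i - {e \<in> P i. V t e = Minus}" by simp
      then have "{e \<in> P i. V t e = Minus} \<subset> P i" by blast
      from psubset_card_mono[OF finP[OF i] this] show ?thesis using i by (simp add: N_def)
    qed
    then show "n \<in> PiE I (\<lambda>i. {1..card (P i)})" using t by (auto simp: N_def)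
  qed
  moreover have "inj_on N (PiE I P)"
  proof (rule inj_onI)
    fix t t' assume t: "t \<in> PiE I P" "t' \<in> PiE I P" "N t = N t'"
    have m: "card {e \<in> P i. V t e = Minus} = card {e \<in> P i. V t' e = Minus}" if "i \<in> I" for i
      using fun_cong[OF t(3), of i] that by (simp add: N_def)
    have "V t = V t'"
      by (rule colorful_determined_by_counts[OF A all]) (use V t zeros m in auto)
    then have "t i = t' i" if "i \<in> I" for i
      using zeros[OF t(1) that] zeros[OF t(2) that] by simp
    then show "t = t'" using t by (intro PiE_ext[of t I P t']) auto
  qed
  moreover have "card (PiE I (\<lambda>i. {1..card (P i)})) = card (PiE I P)"
    by (simp add: card_PiE[OF finite_colors])
  moreover have "finite (PiE I (\<lambda>i. {1..card (P i)}))"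
    by (rule finite_PiE[OF finite_colors]) simp
  ultimately have image: "N ` PiE I P = PiE I (\<lambda>i. {1..card (P i)})"
    using card_subset_eq card_image by metis
  have "restrict \<alpha> I \<in> PiE I (\<lambda>i. {1..card (P i)})" using \<alpha> by simp
  then obtain t where t: "t \<in> PiE I P" "N t = restrict \<alpha> I" unfolding image[symmetric] by (metis imageE)
  have "card {e \<in> P i. V t e = Minus} = \<alpha> i - 1" if "i \<in> I" for i
    using fun_cong[OF t(2), of i] that by (simp add: N_def)
  then show ?thesis using V t zeros[OF t(1)] by (intro bexI[of _ "V t"]) auto
qed

end

section \<open>Rank and uniformity\<close>

lemma not_in_closure_iff:
  "e \<notin> om_closure E L A \<longleftrightarrow> (\<exists>v\<in>L. A \<subseteq> zero_set E v \<and> e \<notin> zero_set E v)"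
  by (auto simp: om_closure_def)

text \<open>The bound on the number of zeros: if a nonzero \<open>v\<close> vanished on a basis \<open>B\<close> but not at \<open>e\<close>, then \<open>insert e B\<close> would be independent: a covector that shows \<open>b\<close> to be outside the closure of \<open>B - {b}\<close>
can be made to vanish at \<open>e\<close> by elimination with \<open>v\<close> or its negative, which vanish on \<open>B\<close>.\<close>
lemma (in oriented_matroid) uniform_om_if_om_uniform:
  assumes uni: "om_uniform E L"
  shows "uniform_om E L (om_rank E L)"
proof -
  define r where "r = om_rank E L"
  have fin: "finite {A. om_indep E L A}"
    by (rule finite_subset[of _ "Pow E"]) (use finite_ground in \<open>auto simp: om_indep_def\<close>)
  have le: "card A \<le> r" if "om_indep E L A" for A
    unfolding r_def om_rank_def by (rule Max_ge) (use fin that in auto)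
  have "om_indep E L {}" by (simp add: om_indep_def)
  then have "r \<in> card ` {A. om_indep E L A}"
    unfolding r_def om_rank_def by (intro Max_in) (use fin in auto)
  then obtain B where "om_indep E L B" "card B = r" by blast
  then have r_le: "r \<le> card E" using card_mono[OF finite_ground, of B] by (auto simp: om_indep_def)
  have indep: "om_indep E L B" if "B \<subseteq> E" "card B = r" for B
    using uni that by (simp add: om_uniform_def om_basis_def r_def)
  have "uniform_om E L r"
  proof (unfold_locales, rule r_le)
    fix v assume v: "v \<in> L" "v \<noteq> null"
    show "card (zero_set E v) < r"
    proof (rule ccontr)
      assume "\<not> card (zero_set E v) < r"
      then obtain B where B: "B \<subseteq> zero_set E v" "card B = r"
        by (meson not_less obtain_subset_with_card_n)
      have BE: "B \<subseteq> E" using B by (auto simp: zero_set_def)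
      obtain e where e: "v e \<noteq> Zero" using v by auto
      then have eE: "e \<in> E" and eB: "e \<notin> B" using zero_off_ground[OF v(1)] B by (auto simp: zero_set_def)
      have "om_indep E L (insert e B)"
        unfolding om_indep_def
      proof (intro conjI ballI)
        show "insert e B \<subseteq> E" using BE eE by simp
        fix b assume b: "b \<in> insert e B"
        show "b \<notin> om_closure E L (insert e B - {b})"
        proof (cases "b = e")
          case True
          then show ?thesis using v B e eB by (auto simp: not_in_closure_iff zero_set_def)
        next
          case False
          then have bB: "b \<in> B" using b by simp
          then obtain X where X: "X \<in> L" "B - {b} \<subseteq> zero_set E X" "b \<notin> zero_set E X"
            using indep[OF BE B(2)] by (auto simp: om_indep_def not_in_closure_iff)
          have "\<exists>Y\<in>L. Y e = Zero \<and> (\<forall>f. v f = Zero \<longrightarrow> Y f = X f)"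
          proof (cases "X e = Zero")
            case True
            then show ?thesis using X by blast
          next
            case False
            have "\<exists>w\<in>L. w e = neg_sign (X e) \<and> (\<forall>f. v f = Zero \<longrightarrow> w f = Zero)"
              using nonzero_sign_cases[OF False e] v neg_covector[OF v(1)]
              by (elim disjE) (force intro: bexI[of _ "opp v"] bexI[of _ v])+
            then obtain w where w: "w \<in> L" "w e = neg_sign (X e)" "\<And>f. v f = Zero \<Longrightarrow> w f = Zero" by blast
            obtain Y where Y: "Y \<in> L" "Y e = Zero"
              "\<And>f. f \<notin> separation_set X w \<Longrightarrow> Y f = compose_sv X w f"
              using eliminate[OF X(1) w(1) False w(2)] by blast
            have "Y f = X f" if "v f = Zero" for f
              using Y(3)[of f] w(3)[OF that] by (auto simp: separation_set_def compose_sv_def)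
            with Y show ?thesis by blast
          qed
          then obtain Y where Y: "Y \<in> L" "Y e = Zero" "\<And>f. v f = Zero \<Longrightarrow> Y f = X f" by blast
          have "v f = Zero" if "f \<in> B" for f using that B by (auto simp: zero_set_def)
          then have "insert e B - {b} \<subseteq> zero_set E Y" "b \<notin> zero_set E Y"
            using Y X(2,3) bB BE eE by (auto simp: zero_set_def)
          then show ?thesis using Y(1) unfolding not_in_closure_iff by blast
        qed
      qed
      from le[OF this] show False
        using B eB finite_subset[OF BE finite_ground] by simp
    qed
  next
    fix Z assume Z: "Z \<subseteq> E" "card Z + 1 = r"
    then have "Z \<noteq> E" using r_le by auto
    then obtain x where x: "x \<in> E" "x \<notin> Z" using Z by blast
    have "om_indep E L (insert x Z)"
      by (rule indep) (use Z x finite_subset[OF Z(1) finite_ground] in auto)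
    then have "x \<notin> om_closure E L (insert x Z - {x})" unfolding om_indep_def by blast
    then have "x \<notin> om_closure E L Z" using x by simp
    then obtain v where "v \<in> L" "Z \<subseteq> zero_set E v" "x \<notin> zero_set E v"
      unfolding not_in_closure_iff by blast
    then show "\<exists>v\<in>L. v \<noteq> null \<and> (\<forall>e\<in>Z. v e = Zero)"
      using x by (intro bexI[of _ v]) (auto simp: zero_set_def)
  qed
  then show ?thesis by (simp add: r_def)
qed

lemma separated_if_well_separated:
  assumes "color_partition E d P" "well_separated E L d P"
  shows "separated L {1..d} P"
  unfolding separated_def
proof (intro allI impI)
  fix s :: "nat \<Rightarrow> sign" assume s: "\<forall>i\<in>{1..d}. s i \<noteq> Zero"
  have "s i \<in> {Minus, Plus}" if "i \<in> {1..d}" for i using bspec[OF s that] by (cases "s i") auto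
  then have "s \<in> {1..d} \<rightarrow> {Minus, Plus}" by blast
  then obtain v where v: "v \<in> L" "\<forall>e\<in>E. v e = s (color d P e)"
    using assms(2) unfolding well_separated_def by blast
  have "v e = s i" if i: "i \<in> {1..d}" "e \<in> P i" for i e
  proof -
    have "j = i" if "j \<in> {1..d} \<and> e \<in> P j" for j
      using assms(1) i that unfolding color_partition_def disjoint_family_on_def by blast
    with i have "color d P e = i" unfolding color_def by (intro the_equality) blast+
    moreover have "e \<in> E" using assms(1) i by (auto simp: color_partition_def)
    ultimately show ?thesis using v by simp
  qed
  with v show "\<exists>v\<in>L. \<forall>i\<in>{1..d}. \<forall>e\<in>P i. v e = s i" by blast
qed

theorem corollary11:
  fixes E :: "'a set" and L :: "('a \<Rightarrow> sign) set" and d :: nat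
    and P :: "nat \<Rightarrow> 'a set" and \<alpha> :: "nat \<Rightarrow> nat"
  assumes "oriented_matroid E L"
    and "om_uniform E L"
    and "om_rank E L = d + 1"
    and "color_partition E d P"
    and "well_separated E L d P"
    and "\<alpha> \<in> (\<Pi> i\<in>{1..d}. {1..card (P i)})"
  shows "\<exists>v\<in>L. \<forall>i\<in>{1..d}.
           card {e \<in> P i. v e = Zero} = 1 \<and> card {e \<in> P i. v e = Minus} = \<alpha> i - 1"
proof -
  interpret uniform_om E L "Suc (card {1..d})"
    using oriented_matroid.uniform_om_if_om_uniform[OF assms(1,2)] assms(3) by simp
  interpret colored_om E L "{1..d}" P
  proof
    fix i assume i: "i \<in> {1..d}"
    then have "\<alpha> i \<in> {1..card (P i)}" using assms(6) by blast
    then show "P i \<noteq> {}" by auto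
    show "P i \<subseteq> E" using assms(4) i by (auto simp: color_partition_def)
  qed (use assms(4) in \<open>auto simp: color_partition_def\<close>)
  show ?thesis
    by (rule colorful_covector_with_counts[OF separated_if_well_separated[OF assms(4,5)]])
      (use assms(4,6) in \<open>auto simp: color_partition_def\<close>)
qed

end
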